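(* Let $m\ge 2$, $n=2m$, $q=2^n$, let $k$ be an integer with $1\le k\le m$, and let $t$ be an odd integer with $1\le t\le 2^m+1$. Set $s_1=2^{k-1}t-\frac{t-1}{2}$, $s_2=2^{k-1}t+\frac{t+1}{2}$, $d_1=s_1(2^m-1)+1$ and $d_2=s_2(2^m-1)+1$. Assume that $(2^k-1)t \not\equiv 0 \pmod{2^m+1}$ and $(2^k+1)t\not\equiv 0 \pmod{2^m+1}$, and let $l=\gcd(t,2^m+1)$. Suppose that at least one of the following conditions holds: (i) $m\equiv -1 \pmod k$; (ii) $\gcd(k,2m)=1$. Then $\mathcal{C}_{q,d_1,d_2}^{\perp}$ is a binary linear code with parameters $[2^n-1,\,4m,\,2^{2m-1}-(3l-1)2^{m-1}]$, and its weight distribution is as follows: \begin{itemize} \item weight $0$: $1$ codeword; \item weight $2^{2m-1}-(3l-1)2^{m-1}$: $\frac{(2^{2m}-1)(2^m+1-2l)(2^m+1-l)}{6l^3}$ codewords; \item weight $2^{2m-1}-(2l-1)2^{m-1}$: $\frac{(2^{2m}-1)((2^m+3)l-2^m-1)(2^m+1-l)}{2l^3}$ codewords; \item weight $2^{2m-1}-(l-1)2^{m-1}$: $\frac{(2^{2m}-1)\left((2^{2m+1}+2^{m+2}+6)l^2-(2^{2m+1}+7\cdot2^m+5)l+(2^m+1)^2\right)}{2l^3}$ codewords; \item weight $2^{2m-1}+2^{m-1}$: $\frac{(2^{2m}-1)\left(6(2^{2m}+1)l^3-(6\cdot2^{2m}+9\cdot2^m+11)l^2+(3\cdot2^{2m}+9\cdot2^m+6)l-(2^m+1)^2\right)}{6l^3}$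 codewords. \end{itemize}
   Context: Let $p$ be a prime (here $p=2$), $q=p^n$, and let $\theta$ be a fixed primitive element of $\mathbb{F}_q$. For a positive integer $i$, $g_i(x)$ denotes the minimal polynomial of $\theta^i$ over $\mathbb{F}_p$. $\mathcal{C}_{q,d_1,d_2}$ is the cyclic code of length $q-1$ over $\mathbb{F}_p$ with generator polynomial $g_{d_1}(x)g_{d_2}(x)$, i.e. the ideal of $\mathbb{F}_p[x]/(x^{q-1}-1)$ generated by $g_{d_1}(x)g_{d_2}(x)$, where a word $(c_0,\dots,c_{q-2})$ is identified with $\sum_i c_i x^i$. $\mathcal{C}_{q,d_1,d_2}^{\perp}$ is its dual code with respect to the standard inner product. An $[N,k,d]$ code is a linear code of length $N$, dimension $k$ and minimum Hamming distance $d$. The weight distribution lists, for each Hamming weight that occurs, the number of codewords of that weight. *)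

theory Defs
  imports
    "HOL-Library.Z2"
    "HOL-Library.Cardinality"
    "HOL-Library.Function_Algebras"
    "HOL-Computational_Algebra.Computational_Algebra"
    "HOL-Number_Theory.Cong"
begin

section \<open>Finite fields of characteristic 2\<close>

definition primitive_element :: "'a::field \<Rightarrow> bool" where
  "primitive_element \<theta> \<longleftrightarrow> range (\<lambda>i::nat. \<theta> ^ i) = UNIV - {0}"

text \<open>
  The prime field is the type \<open>bit\<close>; its embedding \<open>of_bit\<close> into a field is a ring
  homomorphism exactly in characteristic 2, and only then are the notions below meaningful.
\<close>

definition is_min_poly :: "'a::field \<Rightarrow> bit poly \<Rightarrow> bool" where
  "is_min_poly \<alpha> f \<longleftrightarrow>
     lead_coeff f = 1 \<and> poly (map_poly of_bit f) \<alpha> = 0 \<and>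
     (\<forall>h. h \<noteq> 0 \<and> poly (map_poly of_bit h) \<alpha> = 0 \<longrightarrow> degree f \<le> degree h)"

definition min_poly :: "'a::field \<Rightarrow> bit poly" where
  "min_poly \<alpha> = (THE f. is_min_poly \<alpha> f)"

lemma of_bit_add_char2:
  assumes "(2::'a::field) = 0"
  shows "(of_bit (a + b) :: 'a) = of_bit a + of_bit b"
proof -
  have "(1::'a) + 1 = 0" using assms by simp
  then show ?thesis by (cases a; cases b) simp_all
qed

lemma poly_of_bit_add_char2:
  assumes "(2::'a::field) = 0"
  shows "poly (map_poly of_bit (f + g)) (\<alpha>::'a) =
         poly (map_poly of_bit f) \<alpha> + poly (map_poly of_bit g) \<alpha>"
proof -
  have c: "coeff (map_poly (of_bit :: bit \<Rightarrow> 'a) h) i = of_bit (coeff h i)" for h i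
    by (rule coeff_map_poly) simp
  have "map_poly (of_bit :: bit \<Rightarrow> 'a) (f + g) = map_poly of_bit f + map_poly of_bit g"
    by (rule poly_eqI) (simp only: coeff_add c of_bit_add_char2[OF assms])
  then show ?thesis by (simp only: poly_add)
qed

lemma two_eq_zero_of_card:
  assumes "CARD('a::field) = 2 ^ n"
  shows "(2::'a) = 0"
proof -
  have fin: "finite (UNIV :: 'a set)"
    using assms by (metis card.infinite power_not_zero zero_neq_numeral)
  have "(of_nat CARD('a) :: 'a) = 0"
  proof -
    have "(\<Sum>x\<in>(UNIV::'a set). x) = (\<Sum>x\<in>UNIV. x + 1)"
      by (rule sum.reindex_bij_witness[where i = "\<lambda>x. x + 1" and j = "\<lambda>x. x - 1"]) auto
    then show ?thesis using fin by (simp add: sum.distrib)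
  qed
  then show ?thesis using assms by simp
qed

lemma is_min_poly_min_poly:
  fixes \<alpha> :: "'a::field"
  assumes card: "CARD('a) = 2 ^ n"
  shows "is_min_poly \<alpha> (min_poly \<alpha>)"
proof -
  note two = two_eq_zero_of_card[OF card]
  let ?ev = "\<lambda>f. poly (map_poly of_bit f) \<alpha>"
  have monic: "lead_coeff f = 1" if "f \<noteq> 0" for f :: "bit poly"
    using that by (metis bit_not_one_iff leading_coeff_0_iff)
  have fin: "finite (UNIV :: 'a set)"
    using card by (metis card.infinite power_not_zero zero_neq_numeral)
  have "\<not> inj (\<lambda>i::nat. \<alpha> ^ i)"
    using fin by (metis finite_imageD finite_subset infinite_UNIV_nat subset_UNIV)
  then obtain i j :: nat where ij: "i \<noteq> j" "\<alpha> ^ i = \<alpha> ^ j"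
    by (auto simp: inj_def)
  have evm: "?ev (monom 1 k) = \<alpha> ^ k" for k
    by (simp add: map_poly_monom poly_monom)
  have root: "?ev (monom 1 i + monom 1 j) = 0"
    by (simp only: poly_of_bit_add_char2[OF two] evm ij(2)) (simp add: two flip: mult_2)
  have nz: "monom (1::bit) i + monom 1 j \<noteq> 0"
  proof
    assume "monom (1::bit) i + monom 1 j = 0"
    then have "coeff (monom (1::bit) i + monom 1 j) i = 0" by (simp only: coeff_0)
    then show False using ij(1) by simp
  qed
  obtain f where f: "f \<noteq> 0 \<and> ?ev f = 0"
    and least: "\<And>h. h \<noteq> 0 \<and> ?ev h = 0 \<Longrightarrow> degree f \<le> degree h"
    using ex_has_least_nat[of "\<lambda>f. f \<noteq> 0 \<and> ?ev f = 0" _ degree] root nz by blast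
  have "is_min_poly \<alpha> f"
    unfolding is_min_poly_def using f least monic by blast
  moreover have "g = f" if g: "is_min_poly \<alpha> g" for g
  proof (rule ccontr)
    assume "g \<noteq> f"
    have gnz: "g \<noteq> 0" using g by (auto simp: is_min_poly_def)
    have deg: "degree g = degree f"
      using g f least[of g] gnz unfolding is_min_poly_def by (meson order_antisym)
    have add_self: "a + a = 0" for a :: "bit poly"
    proof (rule poly_eqI)
      show "coeff (a + a) i = coeff 0 i" for i by (simp only: coeff_add coeff_0) (cases "coeff a i"; simp)
    qed
    have d: "g + f \<noteq> 0"
      using \<open>g \<noteq> f\<close> add_self[of f] by (metis add_right_cancel)
    have "?ev (g + f) = 0"
      using g f by (simp only: poly_of_bit_add_char2[OF two] is_min_poly_def) simp
    then have le: "degree f \<le> degree (g + f)" using d least by blast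
    have "degree (g + f) \<le> degree f"
      using deg by (metis degree_add_le order_refl)
    then have "coeff (g + f) (degree f) \<noteq> 0"
      using le d by (metis leading_coeff_0_iff order_antisym)
    moreover have "coeff (g + f) (degree f) = 0"
      using monic[OF gnz] monic[of f] f deg by (simp only: coeff_add) simp
    ultimately show False by simp
  qed
  ultimately show ?thesis
    unfolding min_poly_def by (metis theI)
qed


section \<open>Binary linear codes\<close>

text \<open>
  A binary word of length \<open>N\<close> is a function vanishing at all positions \<open>\<ge> N\<close>, so that words of
  length \<open>N\<close> form a subspace of the space of all binary sequences.
\<close>

type_synonym bin_word = "nat \<Rightarrow> bit"

definition words :: "nat \<Rightarrow> bin_word set" where
  "words N = {w. \<forall>i\<ge>N. w i = 0}"

definition word_scale :: "bit \<Rightarrow> bin_word \<Rightarrow> bin_word" where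
  "word_scale c w = (\<lambda>i. c * w i)"

global_interpretation bin: vector_space word_scale
  by unfold_locales (auto simp: word_scale_def fun_eq_iff algebra_simps)

definition linear_code :: "nat \<Rightarrow> nat \<Rightarrow> bin_word set \<Rightarrow> bool" where
  "linear_code N K C \<longleftrightarrow> C \<subseteq> words N \<and> bin.subspace C \<and> bin.dim C = K"

definition hamming_distance :: "nat \<Rightarrow> bin_word \<Rightarrow> bin_word \<Rightarrow> nat" where
  "hamming_distance N u v = card {i. i < N \<and> u i \<noteq> v i}"

definition hamming_weight :: "nat \<Rightarrow> bin_word \<Rightarrow> nat" where
  "hamming_weight N w = card {i. i < N \<and> w i \<noteq> 0}"

text \<open>Meaningful for codes with at least two words; the distances are bounded by \<open>N\<close>.\<close>

definition min_distance :: "nat \<Rightarrow> bin_word set \<Rightarrow> nat" where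
  "min_distance N C = Min {hamming_distance N u v | u v. u \<in> C \<and> v \<in> C \<and> u \<noteq> v}"

definition weight_count :: "nat \<Rightarrow> bin_word set \<Rightarrow> int \<Rightarrow> nat" where
  "weight_count N C j = card {w \<in> C. int (hamming_weight N w) = j}"

definition dual_code :: "nat \<Rightarrow> bin_word set \<Rightarrow> bin_word set" where
  "dual_code N C = {v \<in> words N. \<forall>w\<in>C. (\<Sum>i<N. v i * w i) = 0}"

definition word_poly :: "nat \<Rightarrow> bin_word \<Rightarrow> bit poly" where
  "word_poly N w = (\<Sum>i<N. monom (w i) i)"

text \<open>
  The ideal generated by the class of \<open>g\<close> in \<open>F\<^sub>2[x]/(x\<^sup>N - 1)\<close>, with each residue class
  represented by the word of coefficients of its representative of degree \<open>< N\<close>.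
\<close>

definition cyclic_code :: "nat \<Rightarrow> bit poly \<Rightarrow> bin_word set" where
  "cyclic_code N g =
     {w \<in> words N. \<exists>h. [word_poly N w = h * g] (mod (monom 1 N - 1))}"

definition cyclic_code2 :: "nat \<Rightarrow> 'a::field \<Rightarrow> nat \<Rightarrow> nat \<Rightarrow> bin_word set" where
  "cyclic_code2 q \<theta> d1 d2 =
     cyclic_code (q - 1) (min_poly (\<theta> ^ d1) * min_poly (\<theta> ^ d2))"

end

theory Submission
  imports Defs "HOL-Library.Product_Plus"
begin

text \<open>
  Write \<open>Q = 2\<^sup>m\<close> and let \<open>U\<close> be the group of \<open>(Q + 1)\<close>-th roots of unity in the field with
  \<open>Q\<^sup>2\<close> elements. By trace duality the code consists of the words with entries
  \<open>Tr (a x\<^sup>d\<^sup>1 + b x\<^sup>d\<^sup>2)\<close>, \<open>x\<close> running through the nonzero field elements. Both exponents are Niho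
  exponents, so in polar coordinates \<open>x = y z\<close> with \<open>y\<close> in the subfield of order \<open>Q\<close> and \<open>z \<in> U\<close>
  the argument of the trace is linear in \<open>y\<close>, and the weight is \<open>(Q + 1 - N) Q / 2\<close> where \<open>N\<close> counts the
  \<open>z \<in> U\<close> at which the coefficient of \<open>y\<close> vanishes. Substituting \<open>u = z\<^sup>2\<^sup>t\<close> one finds \<open>N = l M\<close>,
  where \<open>M\<close> is the number of zeros \<open>u\<close> of \<open>P(u) = b' u\<^sup>s\<^sup>+\<^sup>1 + a' u\<^sup>s + a u + b\<close> (with \<open>s = 2\<^sup>k\<close> and
  \<open>a'\<close>, \<open>b'\<close> the conjugates of \<open>a\<close>, \<open>b\<close>) in a subgroup \<open>V\<close> of \<open>U\<close> of order \<open>v = (Q + 1) / l\<close>.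

  Both alternative hypotheses imply \<open>gcd(k, m) = 1\<close>. The cross ratio of four zeros of \<open>P\<close> in \<open>U\<close>
  would be fixed by \<open>x \<mapsto> x\<^sup>s\<close> and by \<open>x \<mapsto> x\<^sup>Q\<close>, hence lie in the prime field, which is impossible;
  so \<open>M \<le> 3\<close> unless \<open>a = b = 0\<close>. Vanishing at at most three points of \<open>U\<close> imposes independent
  conditions on \<open>(a, b)\<close>, because \<open>c (u + u\<^sub>1) (u + u\<^sub>2)\<^sup>s\<close> has the shape of \<open>P\<close> for suitable \<open>c\<close>. This gives
  the binomial moments of \<open>M\<close> of orders 0 to 3, and these determine the weight distribution.
\<close>

section \<open>Finite sets and binomial moments\<close>

text \<open>Double counting of the pairs \<open>(p, W)\<close> with \<open>W\<close> an
  \<open>r\<close>-element subset of \<open>Z p\<close>.\<close>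

lemma sum_choose_card_eq:
  fixes Z :: "'p \<Rightarrow> 'u set"
  assumes "finite A" "finite V" "\<And>p. p \<in> A \<Longrightarrow> Z p \<subseteq> V"
    and "\<And>W. W \<subseteq> V \<Longrightarrow> card W = r \<Longrightarrow> card {p \<in> A. W \<subseteq> Z p} = c"
  shows "(\<Sum>p\<in>A. card (Z p) choose r) = (card V choose r) * c"
proof -
  have "(\<Sum>p\<in>A. card (Z p) choose r) = (\<Sum>p\<in>A. card {W. W \<subseteq> V \<and> card W = r \<and> W \<subseteq> Z p})"
  proof (rule sum.cong[OF refl])
    fix p assume p: "p \<in> A"
    have "{W. W \<subseteq> V \<and> card W = r \<and> W \<subseteq> Z p} = {W. W \<subseteq> Z p \<and> card W = r}"
      using assms(3)[OF p] by auto
    then show "card (Z p) choose r = card {W. W \<subseteq> V \<and> card W = r \<and> W \<subseteq> Z p}"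
      using n_subsets[of "Z p" r] finite_subset[OF assms(3)[OF p] assms(2)] by simp
  qed
  also have "\<dots> = (\<Sum>p\<in>A. \<Sum>W | W \<subseteq> V \<and> card W = r. of_bool (W \<subseteq> Z p))"
    using assms(2) by (intro sum.cong refl) (auto simp: sum.If_cases of_bool_def Int_def conj_assoc)
  also have "\<dots> = (\<Sum>W | W \<subseteq> V \<and> card W = r. \<Sum>p\<in>A. of_bool (W \<subseteq> Z p))"
    by (rule sum.swap)
  also have "\<dots> = (\<Sum>W | W \<subseteq> V \<and> card W = r. c)"
    using assms(1,4) by (intro sum.cong refl) (auto simp: sum.If_cases of_bool_def Int_def)
  also have "\<dots> = (card V choose r) * c"
    using n_subsets[OF assms(2)] by simp
  finally show ?thesis .
qed

text \<open>Every residue class modulo \<open>v\<close> meets the numbers below \<open>v * l\<close>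
  in exactly \<open>l\<close> points. This will express that raising to the power
  \<open>2 * t\<close> is \<open>l\<close>-to-one on \<open>U\<close>.\<close>

lemma card_residue_lift:
  fixes v l :: nat
  assumes "0 < v" and "\<And>i. R i = R (i mod v)"
  shows "card {i. i < v * l \<and> R i} = l * card {j. j < v \<and> R j}"
proof -
  have "bij_betw (\<lambda>(x, j). x * v + j) ({..<l} \<times> {j. j < v \<and> R j}) {i. i < v * l \<and> R i}"
  proof (rule bij_betw_byWitness[where f' = "\<lambda>i. (i div v, i mod v)"])
    show "(\<lambda>(x, j). x * v + j) ` ({..<l} \<times> {j. j < v \<and> R j}) \<subseteq> {i. i < v * l \<and> R i}"
    proof (clarsimp, intro conjI)
      fix x j assume xj: "x < l" "j < v" "R j"
      have "x * v + j < Suc x * v" using xj by simp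
      also have "\<dots> \<le> l * v" using xj by (intro mult_right_mono) auto
      finally show "x * v + j < v * l" by (simp add: mult.commute)
      show "R (x * v + j)" using assms(2)[of "x * v + j"] xj by simp
    qed
    show "(\<lambda>i. (i div v, i mod v)) ` {i. i < v * l \<and> R i} \<subseteq> {..<l} \<times> {j. j < v \<and> R j}"
      using assms by (auto simp: less_mult_imp_div_less mult.commute)
  qed (use assms(1) in auto)
  from bij_betw_same_card[OF this] show ?thesis
    by (simp add: card_cartesian_product)
qed

section \<open>From binomial moments to frequencies\<close>

lemma real_choose_2_3:
  fixes n :: nat
  shows "2 * real (n choose 2) = real n * (real n - 1)"
    and "6 * real (n choose 3) = real n * (real n - 1) * (real n - 2)"
proof -
  show "2 * real (n choose 2) = real n * (real n - 1)"
    using gbinomial_pochhammer'[of "real n" 2]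
    by (simp add: binomial_gbinomial pochhammer_Suc eval_nat_numeral algebra_simps)
  show "6 * real (n choose 3) = real n * (real n - 1) * (real n - 2)"
    using gbinomial_pochhammer'[of "real n" 3]
    by (simp add: binomial_gbinomial pochhammer_Suc eval_nat_numeral algebra_simps)
qed

text \<open>Here \<open>X\<close> stands for \<open>Q\<close>, \<open>Y\<close> for
  \<open>v\<close>, and \<open>c2\<close>, \<open>c3\<close> for the binomial coefficients of
  \<open>v\<close>. The isolated terms \<open>1\<close>, \<open>Y\<close>, \<open>c2\<close>,
  \<open>c3\<close> on the left come from the zero pair, which vanishes at all \<open>Y\<close>
  points. The system is triangular and is solved from the moment of order 3 downwards.\<close>

lemma binomial_moments_solve:
  fixes X Y c2 c3 a0 a1 a2 a3 :: real
  assumes "1 + (a0 + a1 + a2 + a3) = X ^ 4" and "Y + (a1 + 2 * a2 + 3 * a3) = Y * X ^ 3"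
    and "c2 + (a2 + 3 * a3) = c2 * X ^ 2" and "c3 + a3 = c3 * X"
    and c2: "2 * c2 = Y * (Y - 1)" and c3: "6 * c3 = Y * (Y - 1) * (Y - 2)"
  shows "6 * a3 = Y * (Y - 1) * (Y - 2) * (X - 1)"
    and "2 * a2 = Y * (Y - 1) * (X - 1) * (X + 3 - Y)"
    and "2 * a1 = Y * (X - 1) * (2 * (X^2 + X + 1) - 2 * (Y - 1) * (X + 1) + (Y - 1) * (Y - 2))"
    and "6 * a0 = (X - 1) * (6 * (X^3 + X^2 + X + 1) - 6 * Y * (X^2 + X + 1)
           + 3 * Y * (Y - 1) * (X + 1) - Y * (Y - 1) * (Y - 2))"
proof -
  have "6 * a3 = 6 * c3 * (X - 1)" using assms(4) by (simp add: algebra_simps)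
  then show a3: "6 * a3 = Y * (Y - 1) * (Y - 2) * (X - 1)" by (simp only: c3)
  have "2 * a2 = 2 * c2 * (X ^ 2 - 1) - 6 * a3" using assms(3) by (simp add: algebra_simps)
  then show a2: "2 * a2 = Y * (Y - 1) * (X - 1) * (X + 3 - Y)"
    unfolding c2 a3 by (simp add: algebra_simps power2_eq_square)
  have "2 * a1 = 2 * Y * (X ^ 3 - 1) - 2 * (2 * a2) - 6 * a3"
    using assms(2) by (simp add: algebra_simps)
  then show a1: "2 * a1 = Y * (X - 1) * (2 * (X^2 + X + 1) - 2 * (Y - 1) * (X + 1) + (Y - 1) * (Y - 2))"
    unfolding a2 a3 by (simp add: algebra_simps power2_eq_square power3_eq_cube)
  have "6 * a0 = 6 * (X ^ 4 - 1) - 3 * (2 * a1) - 3 * (2 * a2) - 6 * a3"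
    using assms(1) by (simp add: algebra_simps)
  then show "6 * a0 = (X - 1) * (6 * (X^3 + X^2 + X + 1) - 6 * Y * (X^2 + X + 1)
           + 3 * Y * (Y - 1) * (X + 1) - Y * (Y - 1) * (Y - 2))"
    unfolding a1 a2 a3 by (simp add: algebra_simps power2_eq_square power3_eq_cube power4_eq_xxxx)
qed

text \<open>Guarantees that all four nonzero weights occur. Writing \<open>X = Y - 1 + d\<close>
  with \<open>0 \<le> d\<close> turns the long factors into polynomials in \<open>d\<close> whose
  coefficients are nonnegative for \<open>5 \<le> Y\<close>.\<close>

lemma binomial_moments_pos:
  fixes X Y a0 a1 a2 a3 :: real
  assumes a: "6 * a3 = Y * (Y - 1) * (Y - 2) * (X - 1)"
    "2 * a2 = Y * (Y - 1) * (X - 1) * (X + 3 - Y)"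
    "2 * a1 = Y * (X - 1) * (2 * (X^2 + X + 1) - 2 * (Y - 1) * (X + 1) + (Y - 1) * (Y - 2))"
    "6 * a0 = (X - 1) * (6 * (X^3 + X^2 + X + 1) - 6 * Y * (X^2 + X + 1)
           + 3 * Y * (Y - 1) * (X + 1) - Y * (Y - 1) * (Y - 2))"
    and Y: "5 \<le> Y" "Y \<le> X + 1"
  shows "0 < a0 \<and> 0 < a1 \<and> 0 < a2 \<and> 0 < a3"
proof -
  define d where "d = X + 1 - Y"
  have d: "0 \<le> d" "X = Y - 1 + d" using Y by (simp_all add: d_def)
  have X: "0 < X - 1" using Y by simp
  have "0 < 6 * a3" unfolding a(1) using X Y by (intro mult_pos_pos) auto
  moreover have "0 < 2 * a2" unfolding a(2) using X Y by (intro mult_pos_pos) auto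
  moreover have "0 < 2 * a1"
  proof -
    have "2 * (X^2 + X + 1) - 2 * (Y - 1) * (X + 1) + (Y - 1) * (Y - 2) =
        2 * Y * d + 2 * d^2 + Y * (Y - 3) + 4"
      unfolding d(2) by (simp add: algebra_simps power2_eq_square)
    moreover have "0 < 2 * Y * d + 2 * d^2 + Y * (Y - 3) + 4"
      using d(1) Y by (intro add_nonneg_pos add_nonneg_nonneg mult_nonneg_nonneg) auto
    ultimately show ?thesis unfolding a(3) using X Y by (simp only:) (intro mult_pos_pos; simp)
  qed
  moreover have "0 < 6 * a0"
  proof -
    have "6 * (X^3 + X^2 + X + 1) - 6 * Y * (X^2 + X + 1)
           + 3 * Y * (Y - 1) * (X + 1) - Y * (Y - 1) * (Y - 2) =
        3 * d * (Y - 1) * (3 * Y - 4) + 12 * d^2 * (Y - 1) + 6 * d^3 + 2 * Y * (Y - 1) * (Y - 2)"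
      unfolding d(2) by (simp add: algebra_simps power2_eq_square power3_eq_cube)
    moreover have "0 < 3 * d * (Y - 1) * (3 * Y - 4) + 12 * d^2 * (Y - 1) + 6 * d^3 + 2 * Y * (Y - 1) * (Y - 2)"
      using d(1) Y by (intro add_nonneg_pos add_nonneg_nonneg mult_nonneg_nonneg mult_pos_pos) auto
    ultimately show ?thesis unfolding a(4) using X by (simp only:) (intro mult_pos_pos; simp)
  qed
  ultimately show ?thesis by simp
qed

text \<open>Eliminates \<open>Y\<close> by means of \<open>X + 1 = L * Y\<close>, which introduces
  the denominator \<open>L ^ 3\<close>.\<close>

lemma counts_closed_form:
  fixes X Y L a0 a1 a2 a3 :: real
  assumes a: "6 * a3 = Y * (Y - 1) * (Y - 2) * (X - 1)"
    "2 * a2 = Y * (Y - 1) * (X - 1) * (X + 3 - Y)"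
    "2 * a1 = Y * (X - 1) * (2 * (X^2 + X + 1) - 2 * (Y - 1) * (X + 1) + (Y - 1) * (Y - 2))"
    "6 * a0 = (X - 1) * (6 * (X^3 + X^2 + X + 1) - 6 * Y * (X^2 + X + 1)
           + 3 * Y * (Y - 1) * (X + 1) - Y * (Y - 1) * (Y - 2))"
    and L: "0 < L" "X + 1 = L * Y"
  shows "a3 = (X^2 - 1) * (X + 1 - 2 * L) * (X + 1 - L) / (6 * L ^ 3)"
    and "a2 = (X^2 - 1) * ((X + 3) * L - X - 1) * (X + 1 - L) / (2 * L ^ 3)"
    and "a1 = (X^2 - 1) * ((2 * X^2 + 4 * X + 6) * L ^ 2 - (2 * X^2 + 7 * X + 5) * L + (X + 1) ^ 2) / (2 * L ^ 3)"
    and "a0 = (X^2 - 1) * (6 * (X^2 + 1) * L ^ 3 - (6 * X^2 + 9 * X + 11) * L ^ 2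
               + (3 * X^2 + 9 * X + 6) * L - (X + 1) ^ 2) / (6 * L ^ 3)"
proof -
  have div: "a = b / (c * L ^ 3)" if "c * a * L ^ 3 = b" "c \<noteq> 0" for a b c
    using that L by (simp add: field_simps)
  have sq: "X^2 - 1 = (X - 1) * (X + 1)" by (simp add: algebra_simps power2_eq_square)
  have X: "X = L * Y - 1" using L by simp
  show "a3 = (X^2 - 1) * (X + 1 - 2 * L) * (X + 1 - L) / (6 * L ^ 3)"
    by (rule div, unfold a sq L(2)) (simp_all add: algebra_simps power2_eq_square power3_eq_cube)
  show "a2 = (X^2 - 1) * ((X + 3) * L - X - 1) * (X + 1 - L) / (2 * L ^ 3)"
    by (rule div, unfold a X) (simp_all add: algebra_simps power2_eq_square power3_eq_cube)
  show "a1 = (X^2 - 1) * ((2 * X^2 + 4 * X + 6) * L ^ 2 - (2 * X^2 + 7 * X + 5) * L + (X + 1) ^ 2) / (2 * L ^ 3)"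
    by (rule div, unfold a X) (simp_all add: algebra_simps power2_eq_square power3_eq_cube)
  show "a0 = (X^2 - 1) * (6 * (X^2 + 1) * L ^ 3 - (6 * X^2 + 9 * X + 11) * L ^ 2
               + (3 * X^2 + 9 * X + 6) * L - (X + 1) ^ 2) / (6 * L ^ 3)"
    by (rule div, unfold a X) (simp_all add: algebra_simps power2_eq_square power3_eq_cube)
qed

section \<open>The quadratic extension in characteristic 2\<close>

lemma power2k_add:
  assumes "(2::'a::comm_ring_1) = 0"
  shows "((x::'a) + y) ^ (2 ^ k) = x ^ (2 ^ k) + y ^ (2 ^ k)"
proof (induction k)
  case (Suc k)
  have sq: "(a + b)^2 = a^2 + b^2" for a b :: 'a
    by (simp add: power2_sum assms)
  have "(x + y) ^ (2 ^ Suc k) = ((x + y) ^ (2 ^ k))^2"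
    by (simp add: power_mult [symmetric] mult.commute)
  also have "\<dots> = (x ^ (2 ^ k))^2 + (y ^ (2 ^ k))^2"
    by (simp only: Suc sq)
  finally show ?case
    by (simp add: power_mult [symmetric] mult.commute)
qed simp

lemma power2k_sum:
  assumes "(2::'a::comm_ring_1) = 0"
  shows "(\<Sum>i\<in>A. f i :: 'a) ^ (2 ^ k) = (\<Sum>i\<in>A. f i ^ (2 ^ k))"
  by (induction A rule: infinite_finite_induct) (simp_all add: power2k_add[OF assms] power_0_left)

lemma power_fixed_iterate:
  fixes x :: "'a::monoid_mult"
  assumes "x ^ n = x"
  shows "x ^ (n ^ j) = x"
  by (induction j) (simp_all add: power_mult assms)

text \<open>By Bezout \<open>k * i = m * j + 1\<close>, so \<open>i\<close> rounds of the first map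
  equal \<open>j\<close> rounds of the second followed by one squaring. Hence
  \<open>x ^ 2 = x\<close>.\<close>

lemma fixed_by_coprime_frobenius:
  fixes x :: "'a::idom"
  assumes "coprime k m" "0 < k" "x ^ (2 ^ k) = x" "x ^ (2 ^ m) = x"
  shows "x = 0 \<or> x = 1"
proof -
  obtain i j where ij: "k * i = m * j + 1"
    using bezout_nat[of k m] assms(1,2) by (auto simp: coprime_iff_gcd_eq_1)
  have "x = x ^ ((2 ^ k) ^ i)"
    by (rule power_fixed_iterate[OF assms(3), symmetric])
  also have "\<dots> = (x ^ ((2 ^ m) ^ j)) ^ 2"
    by (simp only: power_mult [symmetric] power_add power_one_right ij)
  also have "\<dots> = x ^ 2"
    by (simp only: power_fixed_iterate[OF assms(4)])
  finally have "x * (x - 1) = 0"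
    by (simp add: power2_eq_square algebra_simps)
  then show ?thesis by auto
qed

text \<open>With \<open>p\<close> the order of \<open>\<theta>\<close>, the powers with exponents
  below \<open>p\<close> are distinct and exhaust the \<open>N\<close> nonzero elements, so
  \<open>p = N\<close>.\<close>

lemma primitive_element_power_eq_iff:
  fixes \<theta> :: "'a::field"
  assumes card: "CARD('a) = Suc N" and prim: "primitive_element \<theta>"
  shows "\<theta> ^ i = \<theta> ^ j \<longleftrightarrow> [i = j] (mod N)"
proof -
  have ran: "range (\<lambda>i::nat. \<theta> ^ i) = UNIV - {0}"
    using prim by (simp add: primitive_element_def)
  have fin: "finite (UNIV :: 'a set)"
    using card by (metis card.infinite nat.distinct(1))
  have nz: "\<theta> \<noteq> 0"
    using ran by (metis DiffE insertI1 power_one_right rangeI)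
  have cardN: "card (UNIV - {0::'a}) = N"
    using fin card by (simp add: card_Diff_singleton)
  define p where "p = (LEAST p. 0 < p \<and> \<theta> ^ p = 1)"
  have "\<not> inj (\<lambda>i::nat. \<theta> ^ i)"
    using fin by (metis finite_imageD finite_subset infinite_UNIV_nat subset_UNIV)
  then obtain a b where "a \<noteq> b" "\<theta> ^ a = \<theta> ^ b"
    by (auto simp: inj_def)
  then obtain a b where ab: "a < b" "\<theta> ^ a = \<theta> ^ b"
    by (metis linorder_neqE_nat)
  have "\<theta> ^ a * \<theta> ^ (b - a) = \<theta> ^ a * 1"
    using ab by (metis le_add_diff_inverse less_imp_le mult_1_right power_add)
  then have "0 < b - a \<and> \<theta> ^ (b - a) = 1"
    using ab nz by simp
  then have p: "0 < p \<and> \<theta> ^ p = 1"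
    unfolding p_def by (rule LeastI)
  have least: "\<not> (0 < r \<and> \<theta> ^ r = 1)" if "r < p" for r
    using that not_less_Least unfolding p_def by blast
  have red: "\<theta> ^ i = \<theta> ^ (i mod p)" for i
    by (metis p mult.right_neutral mult_div_mod_eq power_add power_mult power_one mult.left_neutral)
  have inj: "i = j" if "i \<le> j" "j < p" "\<theta> ^ i = \<theta> ^ j" for i j
  proof -
    have "\<theta> ^ i * \<theta> ^ (j - i) = \<theta> ^ i * 1"
      using that by (metis le_add_diff_inverse mult_1_right power_add)
    then have "\<theta> ^ (j - i) = 1" using nz by simp
    then show ?thesis using least[of "j - i"] that by auto
  qed
  have inj': "inj_on (\<lambda>i. \<theta> ^ i) {..<p}"
    by (rule inj_onI) (metis inj lessThan_iff nat_le_linear)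
  have "(\<lambda>i. \<theta> ^ i) ` {..<p} = range (\<lambda>i. \<theta> ^ i)"
  proof
    have "\<theta> ^ i \<in> (\<lambda>i. \<theta> ^ i) ` {..<p}" for i
      using p by (subst red) (rule imageI, simp)
    then show "range (\<lambda>i. \<theta> ^ i) \<subseteq> (\<lambda>i. \<theta> ^ i) ` {..<p}" by blast
  qed auto
  then have pN: "p = N"
    using card_image[OF inj'] ran cardN by simp
  have "\<theta> ^ (i mod p) = \<theta> ^ (j mod p) \<longleftrightarrow> i mod p = j mod p"
    by (rule inj_on_eq_iff[OF inj']) (use p in simp_all)
  then show ?thesis
    unfolding cong_def pN [symmetric] using red[of i] red[of j] by metis
qed

section \<open>The field with \<open>Q * Q\<close> elements, its conjugation and polar
  coordinates\<close>

locale quadratic_extension =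
  fixes \<theta> :: "'a::field" and m Q :: nat
  assumes m: "2 \<le> m" and Q: "Q = 2 ^ m"
    and card_field: "CARD('a) = Q * Q" and prim: "primitive_element \<theta>"
begin

lemma Q_ge: "4 \<le> Q"
  using power_increasing[OF m, of "2::nat"] by (simp add: Q)

lemma order_factor: "Q * Q = Suc ((Q - 1) * (Q + 1))"
  using Q_ge by (cases Q) auto

lemma two: "(2::'a) = 0"
  by (rule two_eq_zero_of_card[of "m + m"]) (simp add: card_field Q power_add)

lemma minus_eq: "(x::'a) - y = x + y"
  using two by (metis add_diff_cancel_right' add_uminus_conv_diff add.inverse_unique mult_2 mult_zero_left)

lemma add_self: "(x::'a) + x = 0"
  by (simp add: two flip: mult_2)

lemma add_eq_0: "(x::'a) + y = 0 \<longleftrightarrow> x = y"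
  by (metis minus_eq right_minus_eq)

lemma fin: "finite (A :: 'a set)"
proof -
  have "CARD('a) \<noteq> 0" using card_field Q_ge by simp
  then show ?thesis by (metis card.infinite finite_subset subset_UNIV)
qed

lemma \<theta>_nz: "\<theta> \<noteq> 0"
  using prim unfolding primitive_element_def by (metis DiffE insertI1 power_one_right rangeI)

lemma \<theta>_power_eq_iff: "\<theta> ^ i = \<theta> ^ j \<longleftrightarrow> [i = j] (mod (Q - 1) * (Q + 1))"
  by (rule primitive_element_power_eq_iff[OF _ prim]) (simp only: card_field order_factor)

lemma log_exists: "x \<noteq> 0 \<Longrightarrow> \<exists>i. x = \<theta> ^ i"
  using prim unfolding primitive_element_def by (metis DiffI UNIV_I empty_iff imageE insert_iff)

lemma power_order: "x \<noteq> 0 \<Longrightarrow> (x::'a) ^ ((Q - 1) * (Q + 1)) = 1"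
proof -
  assume "x \<noteq> 0"
  then obtain i where "x = \<theta> ^ i" using log_exists by blast
  moreover have "\<theta> ^ (i * ((Q - 1) * (Q + 1))) = \<theta> ^ 0"
    unfolding \<theta>_power_eq_iff by (simp add: cong_def)
  ultimately show ?thesis by (simp add: power_mult)
qed

text \<open>The involutive automorphism whose fixed field \<open>FQ\<close> has order
  \<open>Q\<close>; the group \<open>U\<close> is the kernel of the norm
  \<open>x * cnj x\<close>.\<close>

definition cnj :: "'a \<Rightarrow> 'a" where "cnj x = x ^ Q"

definition FQ :: "'a set" where "FQ = {x. cnj x = x}"

definition U :: "'a set" where "U = {x. x ^ (Q + 1) = 1}"

lemma cnj_0 [simp]: "cnj 0 = 0" and cnj_1 [simp]: "cnj 1 = 1"
  using Q_ge by (simp_all add: cnj_def)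

lemma cnj_add [simp]: "cnj (x + y) = cnj x + cnj y"
  by (simp add: cnj_def) (simp only: Q power2k_add[OF two])

lemma cnj_mult [simp]: "cnj (x * y) = cnj x * cnj y"
  by (simp add: cnj_def power_mult_distrib)

lemma cnj_power [simp]: "cnj (x ^ n) = cnj x ^ n"
  by (simp add: cnj_def power_mult [symmetric] mult.commute)

lemma cnj_divide [simp]: "cnj (x / y) = cnj x / cnj y"
  by (simp add: cnj_def power_divide)

lemma cnj_cnj [simp]: "cnj (cnj x) = x"
proof (cases "x = 0")
  case False
  have "cnj (cnj x) = x ^ Suc ((Q - 1) * (Q + 1))"
    by (simp only: cnj_def power_mult [symmetric] order_factor)
  then show ?thesis using power_order[OF False] by simp
qed simp

lemma U_iff: "x \<in> U \<longleftrightarrow> x * cnj x = 1"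
  by (simp add: U_def cnj_def)

lemma U_nz: "x \<in> U \<Longrightarrow> x \<noteq> 0"
  by (auto simp: U_iff)

lemma cnj_U: "x \<in> U \<Longrightarrow> cnj x = 1 / x"
  using U_nz by (simp add: U_iff field_simps)

lemma U_mult: "x \<in> U \<Longrightarrow> y \<in> U \<Longrightarrow> x * y \<in> U"
  by (simp only: U_def mem_Collect_eq power_mult_distrib mult_1)

lemma U_power: "x \<in> U \<Longrightarrow> x ^ n \<in> U"
  by (simp only: U_def mem_Collect_eq power_mult [symmetric] mult.commute[of n]) (simp only: power_mult power_one)

lemma FQ_0: "0 \<in> FQ" and FQ_add: "x \<in> FQ \<Longrightarrow> y \<in> FQ \<Longrightarrow> x + y \<in> FQ"
  and FQ_mult: "x \<in> FQ \<Longrightarrow> y \<in> FQ \<Longrightarrow> x * y \<in> FQ"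
  and FQ_divide: "x \<in> FQ \<Longrightarrow> y \<in> FQ \<Longrightarrow> x / y \<in> FQ"
  by (simp_all add: FQ_def)

lemma FQ_nonzero: "FQ - {0} = {x. x ^ (Q - 1) = 1}"
proof -
  have "cnj x = x * x ^ (Q - 1)" for x
    unfolding cnj_def using Q_ge by (simp flip: power_Suc)
  then show ?thesis
    using Q_ge by (auto simp: FQ_def power_0_left)
qed

text \<open>The quotient \<open>r\<close> of the two subfield parts lies in both \<open>FQ\<close>
  and \<open>U\<close>, so \<open>r * r = 1\<close>; in characteristic 2 this means
  \<open>(r + 1) * (r + 1) = 0\<close>.\<close>

lemma polar_inj:
  assumes "y \<in> FQ - {0}" "z \<in> U" "y' \<in> FQ - {0}" "z' \<in> U" "y * z = y' * z'"
  shows "y = y' \<and> z = z'"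
proof -
  define r where "r = y / y'"
  have r1: "cnj r = r" "r \<noteq> 0" using assms(1,3) by (auto simp: r_def FQ_def)
  have "r = z' / z" using assms U_nz by (auto simp: r_def field_simps)
  then have "r * cnj r = 1" using assms(2,4) U_nz by (simp add: cnj_U)
  then have "(r + 1) * (r + 1) = 0"
    using r1 add_self[of r] add_self[of 1] by (simp add: algebra_simps)
  then have "r = 1" by (simp add: add_eq_0)
  then have "y = y'" using assms(3) by (simp add: r_def)
  then show ?thesis using assms by auto
qed

text \<open>One enumeration serves three groups: \<open>FQ - {0}\<close>, \<open>U\<close>, and
  (with \<open>B = 1\<close>) all nonzero elements.\<close>

lemma roots_of_unity:
  assumes "(Q - 1) * (Q + 1) = A * B"
  shows "bij_betw (\<lambda>i. \<theta> ^ (B * i)) {..<A} {x. x ^ A = 1}"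
proof -
  have pos: "0 < A" "0 < B"
    using assms Q_ge by (auto intro: Nat.gr0I)
  have eq: "\<theta> ^ (B * i) = \<theta> ^ (B * j) \<longleftrightarrow> i mod A = j mod A" for i j
    using pos by (simp only: \<theta>_power_eq_iff assms cong_def mult.commute[of A]) (simp flip: mult_mod_right)
  have "x \<in> (\<lambda>i. \<theta> ^ (B * i)) ` {..<A}" if "x ^ A = 1" for x
  proof -
    have "x \<noteq> 0" using that pos by (auto simp: power_0_left)
    then obtain j where j: "x = \<theta> ^ j" using log_exists by blast
    have "\<theta> ^ (j * A) = \<theta> ^ 0"
      using that by (simp add: j power_mult)
    then have "A * B dvd A * j"
      unfolding \<theta>_power_eq_iff assms by (simp add: cong_0_iff mult.commute)
    then obtain i where i: "j = B * i" using pos by (auto simp: dvd_def)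
    have "\<theta> ^ (B * i) = \<theta> ^ (B * (i mod A))"
      by (simp only: eq mod_mod_trivial)
    then show ?thesis
      unfolding j i by (rule image_eqI) (simp add: pos)
  qed
  moreover have "(\<theta> ^ (B * i)) ^ A = 1" for i
  proof -
    have "(\<theta> ^ (B * i)) ^ A = (\<theta> ^ ((Q - 1) * (Q + 1))) ^ i"
      by (simp only: power_mult [symmetric] assms mult_ac)
    then show ?thesis using power_order[OF \<theta>_nz] by simp
  qed
  moreover have "inj_on (\<lambda>i. \<theta> ^ (B * i)) {..<A}"
    by (rule inj_onI) (simp add: eq)
  ultimately show ?thesis
    by (auto simp: bij_betw_def)
qed

lemma card_FQ: "card FQ = Q"
proof -
  have "card (FQ - {0}) = Q - 1"
    using bij_betw_same_card[OF roots_of_unity[OF refl]] by (simp add: FQ_nonzero)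
  then show ?thesis
    using Q_ge FQ_0 fin[of FQ] by (simp add: card_Diff_singleton)
qed

definition \<zeta> :: 'a where "\<zeta> = \<theta> ^ (Q - 1)"

lemma bij_\<zeta>: "bij_betw (\<lambda>i. \<zeta> ^ i) {..<Q + 1} U"
  using roots_of_unity[OF mult.commute] by (simp only: U_def \<zeta>_def flip: power_mult)

lemma card_U: "card U = Q + 1"
  using bij_betw_same_card[OF bij_\<zeta>] by simp

lemma \<zeta>_power_eq_iff: "\<zeta> ^ i = \<zeta> ^ j \<longleftrightarrow> [i = j] (mod (Q + 1))"
  using Q_ge unfolding \<zeta>_def power_mult [symmetric] \<theta>_power_eq_iff cong_def
  by (simp flip: mult_mod_right del: mult_Suc_right)

lemma U_eq: "U = range (\<lambda>i::nat. \<zeta> ^ i)"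
proof
  show "U \<subseteq> range (\<lambda>i::nat. \<zeta> ^ i)"
    using bij_\<zeta> by (auto simp: bij_betw_def)
  have "\<zeta> ^ i = \<zeta> ^ (i mod (Q + 1))" for i
    unfolding \<zeta>_power_eq_iff by (simp add: cong_def)
  then have "\<zeta> ^ i \<in> U" for i
    using bij_betwE[OF bij_\<zeta>] by (metis lessThan_iff mod_less_divisor zero_less_Suc Suc_eq_plus1)
  then show "range (\<lambda>i::nat. \<zeta> ^ i) \<subseteq> U" by blast
qed

text \<open>If \<open>u = \<zeta> ^ i\<close>, then \<open>\<theta> ^ i\<close> is a solution,
  because conjugation multiplies it by its \<open>(Q - 1)\<close>-th power, which is
  \<open>u\<close>.\<close>

lemma hilbert90:
  assumes "u \<in> U"
  obtains c where "c \<noteq> 0" "cnj c = c * u"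
proof -
  obtain i where "u = \<zeta> ^ i" using assms U_eq by blast
  then have "cnj (\<theta> ^ i) = \<theta> ^ i * u"
    using Q_ge by (simp add: \<zeta>_def cnj_def flip: power_mult power_add) (simp add: algebra_simps flip: power_add)
  then show ?thesis using that \<theta>_nz by (metis power_not_zero)
qed

text \<open>Injectivity suffices, since both sides have \<open>(Q - 1) * (Q + 1)\<close>
  elements.\<close>

lemma bij_polar: "bij_betw (\<lambda>(z, y). y * z) (U \<times> (FQ - {0})) (UNIV - {0})"
proof -
  let ?f = "\<lambda>(z, y). y * z"
  have inj: "inj_on ?f (U \<times> (FQ - {0}))"
  proof (rule inj_onI)
    fix a b assume "a \<in> U \<times> (FQ - {0})" "b \<in> U \<times> (FQ - {0})" "?f a = ?f b"
    then show "a = b"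
      using polar_inj[of "snd a" "fst a" "snd b" "fst b"] by (auto simp: case_prod_beta prod_eq_iff)
  qed
  have "card (U \<times> (FQ - {0})) = (Q + 1) * (Q - 1)"
    using FQ_0 by (simp add: card_cartesian_product card_U card_FQ card_Diff_singleton fin)
  then have "card (?f ` (U \<times> (FQ - {0}))) = card (UNIV - {0::'a})"
    using card_image[OF inj] card_field order_factor fin[of UNIV] by (simp add: card_Diff_singleton mult.commute)
  moreover have "?f ` (U \<times> (FQ - {0})) \<subseteq> UNIV - {0}"
    using U_nz by auto
  ultimately have "?f ` (U \<times> (FQ - {0})) = UNIV - {0}"
    using card_subset_eq[OF fin] by blast
  then show ?thesis using inj by (simp add: bij_betw_def)
qed

end

section \<open>Zeros of Niho polynomials on the unit circle\<close>

context quadratic_extension begin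

definition P :: "nat \<Rightarrow> 'a \<Rightarrow> 'a \<Rightarrow> 'a \<Rightarrow> 'a" where
  "P k a b u = cnj b * u ^ (2 ^ k + 1) + cnj a * u ^ (2 ^ k) + a * u + b"

lemma P_add: "P k (a + a') (b + b') u = P k a b u + P k a' b' u"
  by (simp add: P_def algebra_simps)

lemma P_scale: "y \<in> FQ \<Longrightarrow> P k (y * a) (y * b) u = y * P k a b u"
  by (simp add: P_def FQ_def algebra_simps)

text \<open>Conjugation inverts \<open>u\<close>, so the factor \<open>u ^ (2 ^ k + 1)\<close>
  reverses the order of the coefficients, and \<open>P\<close> is self-reciprocal up to conjugation.
  Consequently the quotient of two values at the same \<open>u\<close> lies in
  \<open>FQ\<close>.\<close>

lemma cnj_P: "u \<in> U \<Longrightarrow> cnj (P k a b u) * u ^ (2 ^ k + 1) = P k a b u"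
proof -
  assume u: "u \<in> U"
  have nz: "u \<noteq> 0" using U_nz[OF u] .
  have "cnj (P k a b u) * u ^ (2 ^ k + 1) = b * ((cnj u * u) ^ (2 ^ k) * (cnj u * u)) +
      a * u * (cnj u * u) ^ (2 ^ k) + cnj a * (cnj u * u) * u ^ (2 ^ k) + cnj b * u ^ (2 ^ k + 1)"
    by (simp add: P_def power_mult_distrib algebra_simps)
  moreover have "cnj u * u = 1" using u by (simp add: U_iff mult.commute)
  ultimately show ?thesis by (simp add: P_def)
qed

text \<open>A zero satisfies \<open>u ^ (2 ^ k) * L u = a * u + b\<close>: on zeros the Frobenius
  power acts as a fractional linear map with denominator \<open>L\<close> and determinant
  \<open>D\<close>. Such maps preserve cross ratios, and so does the inversion that
  \<open>cnj\<close> induces on \<open>U\<close>.\<close>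

lemma at_most_three_zeros:
  assumes "coprime k m" "0 < k" and U: "{u1, u2, u3, u4} \<subseteq> U" and dist: "distinct [u1, u2, u3, u4]"
    and zero: "\<And>u. u \<in> {u1, u2, u3, u4} \<Longrightarrow> P k a b u = 0"
  shows "a = 0 \<and> b = 0"
proof (rule ccontr)
  assume nz: "\<not> (a = 0 \<and> b = 0)"
  define L where "L u = cnj b * u + cnj a" for u
  define D where "D = a * cnj a + b * cnj b"
  let ?s = "2 ^ k :: nat"
  have frob: "(x + y) ^ ?s = x ^ ?s + (y::'a) ^ ?s" for x y
    by (rule power2k_add[OF two])
  have zL: "u ^ ?s * L u = a * u + b" if "u \<in> {u1, u2, u3, u4}" for u
    using zero[OF that] by (subst add_eq_0 [symmetric]) (simp add: P_def L_def algebra_simps)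
  \<comment> \<open>The usual formula for the difference of two images under a fractional linear
    map, with denominators cleared and signs dropped.\<close>
  have LL: "(u + v) ^ ?s * (L u * L v) = D * (u + v)"
    if "u \<in> {u1, u2, u3, u4}" "v \<in> {u1, u2, u3, u4}" for u v
  proof -
    have "(u + v) ^ ?s * (L u * L v) = (u ^ ?s * L u) * L v + (v ^ ?s * L v) * L u"
      by (simp add: frob algebra_simps)
    also have "\<dots> = (a * u + b) * L v + (a * v + b) * L u"
      using zL that by simp
    also have "\<dots> = D * (u + v) + (a * cnj b * u * v + a * cnj b * u * v) + (b * cnj a + b * cnj a)"
      by (simp add: L_def D_def algebra_simps)
    finally show ?thesis by (simp only: add_self add_0_right)
  qed
  have L_two: "\<not> (L u = 0 \<and> L v = 0)" if "u \<noteq> v" for u v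
  proof
    assume *: "L u = 0 \<and> L v = 0"
    then have "L u + L v = 0" by simp
    then have "cnj b * (u + v) + (cnj a + cnj a) = 0" by (simp add: L_def algebra_simps)
    then have "cnj b = 0" using that by (simp add: add_self add_eq_0)
    moreover from this * have "cnj a = 0" by (simp add: L_def)
    ultimately show False using nz by (metis cnj_cnj cnj_0)
  qed
  \<comment> \<open>Otherwise all products of two of \<open>L u1\<close>, \<open>L u2\<close>,
    \<open>L u3\<close> vanish, hence two of these values are zero, against
    \<open>L_two\<close>.\<close>
  have D: "D \<noteq> 0"
  proof
    assume "D = 0"
    then have "L u1 * L u2 = 0" "L u1 * L u3 = 0" "L u2 * L u3 = 0"
      using LL[of u1 u2] LL[of u1 u3] LL[of u2 u3] dist by (auto simp: add_eq_0)
    then show False using L_two dist by auto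
  qed
  have Lnz: "L u1 * L u2 * L u3 * L u4 \<noteq> 0"
    using LL[of u1 u2] LL[of u3 u4] D dist by (auto simp: add_eq_0)
  define r where "r = ((u1 + u2) * (u3 + u4)) / ((u1 + u3) * (u2 + u4))"
  have den: "(u1 + u3) * (u2 + u4) \<noteq> 0" using dist by (auto simp: add_eq_0)
  \<comment> \<open>Numerator and denominator are both extended by
    \<open>L u1 * L u2 * L u3 * L u4\<close>, so that \<open>LL\<close> applies to each
    pair.\<close>
  have "r ^ ?s = ((u1 + u2) ^ ?s * (L u1 * L u2) * ((u3 + u4) ^ ?s * (L u3 * L u4))) /
      ((u1 + u3) ^ ?s * (L u1 * L u3) * ((u2 + u4) ^ ?s * (L u2 * L u4)))"
    using Lnz den by (simp add: r_def power_divide power_mult_distrib)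
  also have "\<dots> = r"
    using D den by (simp add: LL r_def)
  finally have r1: "r ^ (2 ^ k) = r" .
  have nzu: "u1 \<noteq> 0" "u2 \<noteq> 0" "u3 \<noteq> 0" "u4 \<noteq> 0" using U U_nz by auto
  have cu: "cnj (u + v) = (u + v) / (u * v)" if "u \<in> {u1, u2, u3, u4}" "v \<in> {u1, u2, u3, u4}" for u v
  proof -
    have uv: "u \<in> U" "v \<in> U" using that U by blast+
    then show ?thesis using U_nz[of u] U_nz[of v] by (simp add: cnj_U field_simps)
  qed
  have "cnj r = r"
    using den nzu by (simp add: r_def cu del: cnj_add)
  then have "r ^ (2 ^ m) = r" by (simp only: cnj_def flip: Q)
  with r1 have "r = 0 \<or> r = 1"
    using fixed_by_coprime_frobenius assms(1,2) by blast
  moreover have "r \<noteq> 0" using dist den by (auto simp: r_def add_eq_0)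
  \<comment> \<open>In characteristic 2 the numerator and denominator of \<open>r\<close> add up to
    \<open>(u1 + u4) * (u2 + u3)\<close>, which is nonzero.\<close>
  moreover have "r \<noteq> 1"
  proof
    assume "r = 1"
    then have "(u1 + u2) * (u3 + u4) = (u1 + u3) * (u2 + u4)"
      using den by (simp only: r_def divide_eq_1_iff)
    then have "(u1 + u2) * (u3 + u4) + (u1 + u3) * (u2 + u4) = 0"
      by (simp only: add_self)
    moreover have "(u1 + u2) * (u3 + u4) + (u1 + u3) * (u2 + u4) =
        (u1 + u4) * (u2 + u3) + (u1 * u4 + u1 * u4) + (u2 * u3 + u2 * u3)"
      by (simp add: algebra_simps)
    ultimately have "(u1 + u4) * (u2 + u3) = 0" by (simp only: add_self add_0_right)
    then show False using dist by (simp add: add_self add_eq_0)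
  qed
  ultimately show False by blast
qed

lemma card_zeros_le_3:
  assumes "coprime k m" "0 < k" "V \<subseteq> U" "(a, b) \<noteq> (0, 0)"
  shows "card {u \<in> V. P k a b u = 0} \<le> 3"
proof (rule ccontr)
  assume "\<not> ?thesis"
  then have "4 \<le> card {u \<in> V. P k a b u = 0}" by simp
  then obtain T where T: "T \<subseteq> {u \<in> V. P k a b u = 0}" "card T = 4"
    by (metis obtain_subset_with_card_n)
  from T(2) obtain u1 u2 u3 u4 where "T = {u1, u2, u3, u4}" "distinct [u1, u2, u3, u4]"
    by (auto simp: numeral_eq_Suc card_Suc_eq)
  then show False
    using at_most_three_zeros[OF assms(1,2), of u1 u2 u3 u4 a b] T(1) assms(3,4) by blast
qed

text \<open>The expanded product has the conjugate symmetry of \<open>P\<close> once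
  \<open>cnj c = c * (u1 * u2 ^ (2 ^ k))\<close>, which \<open>hilbert90\<close> solves. The case
  \<open>u1 = u2\<close> is allowed.\<close>

lemma P_with_zeros:
  assumes "u1 \<in> U" "u2 \<in> U"
  obtains c a b where "c \<noteq> 0" "\<And>x. P k a b x = c * ((x + u1) * (x + u2) ^ (2 ^ k))"
proof -
  have "u1 * u2 ^ (2 ^ k) \<in> U" using assms U_mult U_power by blast
  then obtain c where c: "c \<noteq> 0" "cnj c = c * (u1 * u2 ^ (2 ^ k))"
    using hilbert90 by blast
  have "P k (c * u2 ^ (2 ^ k)) (cnj c) x = c * ((x + u1) * (x + u2) ^ (2 ^ k))" for x
  proof -
    have "cnj (c * u2 ^ (2 ^ k)) = c * u1"
      using assms U_nz by (simp add: c(2) cnj_U field_simps)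
    then show ?thesis
      by (simp add: P_def power2k_add[OF two] algebra_simps) (simp add: c(2) algebra_simps)
  qed
  then show ?thesis using that c(1) by blast
qed

lemma P_separating:
  assumes "W \<subseteq> U" "card W \<le> 2" "u \<in> U" "u \<notin> W"
  obtains a b where "\<And>w. w \<in> W \<Longrightarrow> P k a b w = 0" "P k a b u \<noteq> 0"
proof -
  \<comment> \<open>A smaller \<open>W\<close> is padded: a single point is repeated, and for empty
    \<open>W\<close> any point of \<open>U\<close> other than \<open>u\<close> will do.\<close>
  have "\<exists>u1 u2. u1 \<in> U \<and> u2 \<in> U \<and> W \<subseteq> {u1, u2} \<and> u \<notin> {u1, u2}"
  proof -
    consider "card W = 0" | "card W = 1" | "card W = 2" using assms(2) by linarith
    then show ?thesis
    proof cases
      case 1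
      have "\<not> U \<subseteq> {u}"
        using card_mono[of "{u}" U] card_U Q_ge by auto
      then show ?thesis using 1 fin[of W] by auto
    next
      case 2
      then show ?thesis using assms by (auto simp: card_1_singleton_iff)
    next
      case 3
      then show ?thesis using assms by (auto simp: card_2_iff)
    qed
  qed
  then obtain u1 u2 where u: "u1 \<in> U" "u2 \<in> U" "W \<subseteq> {u1, u2}" "u \<notin> {u1, u2}" by blast
  obtain c a b where "c \<noteq> 0" "\<And>x. P k a b x = c * ((x + u1) * (x + u2) ^ (2 ^ k))"
    by (rule P_with_zeros[OF u(1,2), of k]) (rule that)
  note c = this
  show ?thesis
  proof (rule that)
    show "P k a b w = 0" if "w \<in> W" for w
      using that u(3) by (auto simp: c(2) add_self power_0_left)
    show "P k a b u \<noteq> 0"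
      using c(1) u(4) by (simp add: c(2) add_eq_0)
  qed
qed

text \<open>Each further point divides the number of pairs by \<open>Q\<close>: a pair vanishing on
  \<open>W\<close> is uniquely a pair vanishing also at \<open>u\<close> plus an
  \<open>FQ\<close>-multiple of the separating pair \<open>(a, b)\<close>.\<close>

lemma card_P_vanishing:
  assumes "finite W" "W \<subseteq> U" "card W \<le> 3"
  shows "card {p. W \<subseteq> {u. P k (fst p) (snd p) u = 0}} * Q ^ card W = Q ^ 4"
  using assms
proof (induction W rule: finite_induct)
  case empty
  have "card (UNIV :: ('a \<times> 'a) set) = (Q * Q) * (Q * Q)"
    by (simp add: card_field card_cartesian_product flip: UNIV_Times_UNIV)
  then show ?case by (simp add: numeral_eq_Suc)
next
  case (insert u W)
  let ?K = "\<lambda>W. {p. W \<subseteq> {u. P k (fst p) (snd p) u = 0}}"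
  obtain a b where ab: "\<And>w. w \<in> W \<Longrightarrow> P k a b w = 0" "P k a b u \<noteq> 0"
    by (rule P_separating[of W u k]) (use insert in auto)
  have inF: "P k (fst p) (snd p) u / P k a b u \<in> FQ" for p
  proof -
    have uU: "u \<in> U" using insert.prems by simp
    have "cnj (P k (fst p) (snd p) u) / cnj (P k a b u) =
      (cnj (P k (fst p) (snd p) u) * u ^ (2 ^ k + 1)) / (cnj (P k a b u) * u ^ (2 ^ k + 1))"
      using U_nz[OF uU] by simp
    then show ?thesis unfolding cnj_P[OF uU] by (simp add: FQ_def)
  qed
  let ?f = "\<lambda>(p, y). (fst p + y * a, snd p + y * b)"
  \<comment> \<open>The multiple \<open>y\<close> is chosen to cancel the value at \<open>u\<close>;
    adding it is the same as subtracting it.\<close>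
  let ?g = "\<lambda>p. let y = P k (fst p) (snd p) u / P k a b u in ((fst p + y * a, snd p + y * b), y)"
  have "bij_betw ?f (?K (insert u W) \<times> FQ) (?K W)"
  proof (rule bij_betw_byWitness[where f' = ?g])
    show "\<forall>x\<in>?K (insert u W) \<times> FQ. ?g (?f x) = x"
      using ab by (auto simp: P_add P_scale Let_def add.assoc add_self)
    show "\<forall>p\<in>?K W. ?f (?g p) = p"
      by (auto simp: Let_def add.assoc add_self)
    show "?f ` (?K (insert u W) \<times> FQ) \<subseteq> ?K W"
      using ab(1) by (auto simp: P_add P_scale)
    show "?g ` ?K W \<subseteq> ?K (insert u W) \<times> FQ"
      using ab inF by (auto simp: P_add P_scale Let_def simp del: times_divide_eq_left) (simp add: add_self)
  qed
  from bij_betw_same_card[OF this]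
  have "card (?K W) = card (?K (insert u W)) * Q"
    by (simp add: card_cartesian_product card_FQ)
  then show ?case using insert by (simp add: mult_ac)
qed

lemma sum_choose_zeros:
  assumes "V \<subseteq> U" "r \<le> 3"
  shows "(\<Sum>p\<in>UNIV. card {u \<in> V. P k (fst p) (snd p) u = 0} choose r) = (card V choose r) * Q ^ (4 - r)"
proof (rule sum_choose_card_eq[where Z = "\<lambda>p. {u \<in> V. P k (fst p) (snd p) u = 0}" and A = UNIV])
  show "finite (UNIV :: ('a \<times> 'a) set)"
    unfolding UNIV_Times_UNIV [symmetric] by (intro finite_cartesian_product fin)
  fix W assume W: "W \<subseteq> V" "card W = r"
  have "{p \<in> UNIV. W \<subseteq> {u \<in> V. P k (fst p) (snd p) u = 0}} = {p. W \<subseteq> {u. P k (fst p) (snd p) u = 0}}"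
    using W(1) by auto
  moreover have "card {p. W \<subseteq> {u. P k (fst p) (snd p) u = 0}} * Q ^ r = Q ^ (4 - r) * Q ^ r"
    using card_P_vanishing[of W k] W assms fin[of W] by (simp flip: power_add)
  ultimately show "card {p \<in> UNIV. W \<subseteq> {u \<in> V. P k (fst p) (snd p) u = 0}} = Q ^ (4 - r)"
    using Q_ge by simp
qed (use fin in blast)+

end

section \<open>Traces and weights\<close>

lemma card_Collect_bij_betw:
  assumes "bij_betw f A B"
  shows "card {a \<in> A. R (f a)} = card {b \<in> B. R b}"
proof -
  have "bij_betw f {a \<in> A. R (f a)} {b \<in> B. R b}"
    using assms by (auto simp: bij_betw_def inj_on_def)
  then show ?thesis by (rule bij_betw_same_card)
qed

context quadratic_extension begin

text \<open>On \<open>FQ\<close> this is the absolute trace. Composed with the relative trace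
  \<open>x + cnj x\<close> it gives the absolute trace \<open>Tr\<close> of the whole field.\<close>

definition tr :: "'a \<Rightarrow> 'a" where "tr x = (\<Sum>i<m. x ^ (2 ^ i))"

definition Tr :: "'a \<Rightarrow> 'a" where "Tr x = tr (x + cnj x)"

lemma tr_0 [simp]: "tr 0 = 0"
  by (simp add: tr_def power_0_left)

lemma tr_add: "tr (x + y) = tr x + tr y"
  by (simp add: tr_def power2k_add[OF two] sum.distrib)

text \<open>Squaring permutes the summands cyclically because \<open>x ^ (2 ^ m) = x\<close>, so
  \<open>tr x\<close> is idempotent.\<close>

lemma tr_cases:
  assumes "x \<in> FQ"
  shows "tr x = 0 \<or> tr x = 1"
proof -
  have "tr x ^ 2 = (\<Sum>i<m. x ^ (2 ^ Suc i))"
    using power2k_sum[OF two, of "\<lambda>i. x ^ (2 ^ i)" "{..<m}" 1]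
    by (simp add: tr_def power_mult [symmetric] mult.commute)
  also have "x + \<dots> = tr x + x ^ (2 ^ m)"
    using sum.lessThan_Suc_shift[of "\<lambda>i. x ^ (2 ^ i)" m] by (simp add: tr_def)
  also have "x ^ (2 ^ m) = x"
    using assms by (simp add: FQ_def cnj_def flip: Q)
  finally have "tr x ^ 2 = tr x" by (metis add.commute add_left_cancel)
  then have "tr x * (tr x - 1) = 0" by (simp add: power2_eq_square algebra_simps)
  then show ?thesis by auto
qed

text \<open>Otherwise a nonzero polynomial of degree at most \<open>2 ^ (m - 1)\<close> would have
  \<open>Q = 2 ^ m\<close> roots.\<close>

lemma tr_nontrivial: "\<exists>e\<in>FQ. tr e = 1"
proof (rule ccontr)
  assume "\<not> ?thesis"
  then have zero: "tr x = 0" if "x \<in> FQ" for x using tr_cases that by blast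
  define p :: "'a poly" where "p = (\<Sum>i<m. monom 1 (2 ^ i))"
  have poly_p: "poly p x = tr x" for x
    by (simp add: p_def tr_def poly_sum poly_monom)
  have "coeff p 1 = (\<Sum>i<m. if i = 0 then 1 else 0)"
    unfolding p_def coeff_sum by (intro sum.cong) auto
  then have "p \<noteq> 0" using m by auto
  have "Q \<le> card {x. poly p x = 0}"
    using zero fin card_mono[of "{x. poly p x = 0}" FQ] by (auto simp: poly_p card_FQ)
  also have "\<dots> \<le> degree p"
    by (rule card_poly_roots_bound) fact
  also have "\<dots> \<le> 2 ^ (m - 1)"
    unfolding p_def
    by (rule degree_sum_le) (auto intro: order_trans[OF degree_monom_le] power_increasing)
  also have "\<dots> < Q" using m by (simp add: Q)
  finally show False by simp
qed

text \<open>For \<open>tr e = 1\<close>, translation by \<open>e / f\<close> exchanges the elements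
  with \<open>tr (y * f) = 0\<close> and those with \<open>tr (y * f) = 1\<close>.\<close>

lemma card_tr_nonzero:
  assumes f: "f \<in> FQ"
  shows "2 * card {y \<in> FQ - {0}. tr (y * f) \<noteq> 0} = (if f = 0 then 0 else Q)"
proof (cases "f = 0")
  case False
  obtain e where e: "e \<in> FQ" "tr e = 1" using tr_nontrivial by blast
  define A B where "A = {y \<in> FQ. tr (y * f) \<noteq> 0}" and "B = {y \<in> FQ. tr (y * f) = 0}"
  have eq: "tr ((y + e / f) * f) = tr (y * f) + 1" for y
    using False e(2) by (simp add: distrib_right tr_add)
  have "bij_betw (\<lambda>y. y + e / f) A B"
  proof (rule bij_betw_byWitness[where f' = "\<lambda>y. y + e / f"])
    have "tr (y * f) + 1 = 0" if "y \<in> A" for y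
      using tr_cases[OF FQ_mult[OF _ f], of y] that by (auto simp: A_def two)
    then show "(\<lambda>y. y + e / f) ` A \<subseteq> B"
      using f e(1) by (auto simp: A_def B_def eq FQ_add FQ_divide)
    show "(\<lambda>y. y + e / f) ` B \<subseteq> A"
      using f e(1) by (auto simp: A_def B_def eq FQ_add FQ_divide)
  qed (simp_all add: add.assoc add_self)
  then have "card A = card B" by (rule bij_betw_same_card)
  moreover have "card A + card B = card FQ"
    by (subst card_Un_disjoint [symmetric]) (auto simp: A_def B_def fin intro: arg_cong[where f = card])
  moreover have "{y \<in> FQ - {0}. tr (y * f) \<noteq> 0} = A" by (auto simp: A_def)
  ultimately show ?thesis using False by (simp add: card_FQ)
qed simp

lemma add_cnj_FQ: "x + cnj x \<in> FQ"
  by (simp add: FQ_def add.commute)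

lemma Tr_add: "Tr (x + y) = Tr x + Tr y"
  by (simp add: Tr_def tr_add [symmetric] add_ac)

lemma Tr_0 [simp]: "Tr 0 = 0"
  by (simp add: Tr_def)

lemma Tr_cases: "Tr x = 0 \<or> Tr x = 1"
  unfolding Tr_def by (rule tr_cases[OF add_cnj_FQ])

lemma bij_\<theta>: "bij_betw (\<lambda>i. \<theta> ^ i) {..<Q * Q - 1} (UNIV - {0})"
proof -
  have "{x::'a. x ^ ((Q - 1) * (Q + 1)) = 1} = UNIV - {0}"
    using power_order Q_ge by (auto simp: power_0_left)
  moreover have "Q * Q - 1 = (Q - 1) * (Q + 1)"
    by (simp only: order_factor diff_Suc_1)
  ultimately show ?thesis
    using roots_of_unity[of "(Q - 1) * (Q + 1)" 1] by simp
qed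

text \<open>The defining property of Niho exponents: they act as the identity on the
  subfield.\<close>

lemma FQ_power_Suc:
  assumes "y \<in> FQ - {0}"
  shows "y ^ (s * (Q - 1) + 1) = y"
proof -
  have "y ^ (Q - 1) = 1" using assms FQ_nonzero by blast
  then show ?thesis by (simp add: power_mult mult.commute[of s])
qed

end

text \<open>The formulas for \<open>s1\<close> and \<open>s2\<close> are doubled to avoid halves.
  The two incongruence hypotheses of the theorem enter as \<open>5 \<le> v\<close>.\<close>

locale niho_pair = quadratic_extension +
  fixes k t l v s1 s2 d1 d2 :: nat
  assumes cop: "coprime k m" and k: "0 < k"
    and l: "l = gcd t (Q + 1)" and lv: "Q + 1 = l * v" and v: "5 \<le> v"
    and d1: "d1 = s1 * (Q - 1) + 1" "2 * s1 = (2 ^ k - 1) * t + 1"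
    and d2: "d2 = s2 * (Q - 1) + 1" "2 * s2 = (2 ^ k + 1) * t + 1"
begin

text \<open>The image of \<open>U\<close> under the power map with exponent \<open>2 * t\<close>,
  listed without repetition.\<close>

definition V :: "'a set" where "V = (\<lambda>j. \<zeta> ^ (2 * t * j)) ` {..<v}"

definition M :: "'a \<times> 'a \<Rightarrow> nat" where
  "M p = card {u \<in> V. P k (fst p) (snd p) u = 0}"

text \<open>After cancelling \<open>l\<close> from \<open>t\<close> and from \<open>Q + 1\<close>,
  the remaining factor \<open>2 * t'\<close> is coprime to \<open>v\<close>, which is odd as a
  divisor of \<open>Q + 1\<close>.\<close>

lemma \<zeta>_2t_power_eq_iff: "\<zeta> ^ (2 * t * i) = \<zeta> ^ (2 * t * j) \<longleftrightarrow> i mod v = j mod v"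
proof -
  have lpos: "0 < l" using lv by (cases l) auto
  obtain t' where t': "t = l * t'" using l by (metis gcd_dvd1 dvdE)
  have "gcd (l * t') (l * v) = l" using l lv t' by simp
  then have "coprime t' v" using lpos by (simp add: gcd_mult_left coprime_iff_gcd_eq_1)
  moreover have "odd (Q + 1)" using m by (simp add: Q)
  then have "odd v" using lv by (metis even_mult_iff)
  ultimately have cop: "coprime (2 * t') v" by simp
  have "\<zeta> ^ (2 * t * i) = \<zeta> ^ (2 * t * j) \<longleftrightarrow> [l * (2 * t' * i) = l * (2 * t' * j)] (mod l * v)"
    unfolding \<zeta>_power_eq_iff lv t' by (simp only: mult_ac)
  also have "\<dots> \<longleftrightarrow> [2 * t' * i = 2 * t' * j] (mod v)"
    using lpos by (simp add: cong_def flip: mult_mod_right)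
  also have "\<dots> \<longleftrightarrow> [i = j] (mod v)"
    by (rule cong_mult_lcancel_nat[OF cop])
  finally show ?thesis by (simp add: cong_def)
qed

lemma bij_V: "bij_betw (\<lambda>j. \<zeta> ^ (2 * t * j)) {..<v} V"
  unfolding bij_betw_def V_def by (auto intro: inj_onI simp: \<zeta>_2t_power_eq_iff)

lemma card_V: "card V = v"
  using bij_betw_same_card[OF bij_V] by simp

lemma V_sub_U: "V \<subseteq> U"
  unfolding V_def U_eq by blast

lemma card_U_power:
  "card {z \<in> U. R (z ^ (2 * t))} = l * card {u \<in> V. R u}"
proof -
  have vpos: "0 < v" using v by simp
  have "card {z \<in> U. R (z ^ (2 * t))} = card {i \<in> {..<Q + 1}. R ((\<zeta> ^ i) ^ (2 * t))}"
    by (rule card_Collect_bij_betw[OF bij_\<zeta>, symmetric])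
  also have "\<dots> = card {i. i < v * l \<and> R (\<zeta> ^ (2 * t * i))}"
    by (simp only: lessThan_iff lv power_mult [symmetric] mem_Collect_eq) (simp only: mult_ac)
  also have "\<dots> = l * card {j. j < v \<and> R (\<zeta> ^ (2 * t * j))}"
  proof (rule card_residue_lift[OF vpos])
    show "R (\<zeta> ^ (2 * t * i)) = R (\<zeta> ^ (2 * t * (i mod v)))" for i
      using \<zeta>_2t_power_eq_iff[of i "i mod v"] by simp
  qed
  also have "card {j. j < v \<and> R (\<zeta> ^ (2 * t * j))} = card {u \<in> V. R u}"
    using card_Collect_bij_betw[OF bij_V, of R] by simp
  finally show ?thesis .
qed

section \<open>Trace words and their weights\<close>

definition arg :: "'a \<Rightarrow> 'a \<Rightarrow> 'a \<Rightarrow> 'a" where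
  "arg a b x = a * x ^ d1 + b * x ^ d2"

definition codeword :: "'a \<times> 'a \<Rightarrow> bin_word" where
  "codeword p = (\<lambda>i. if i < Q * Q - 1 \<and> Tr (arg (fst p) (snd p) (\<theta> ^ i)) \<noteq> 0 then 1 else 0)"

lemma arg_polar:
  assumes "y \<in> FQ - {0}"
  shows "arg a b (y * z) = y * arg a b z"
proof -
  have "y ^ d1 = y" "y ^ d2 = y"
    by (simp_all only: d1(1) d2(1) FQ_power_Suc[OF assms])
  then show ?thesis
    by (simp add: arg_def power_mult_distrib algebra_simps)
qed

text \<open>Multiplying the relative trace by the nonzero factor \<open>z ^ e2\<close> yields
  exactly \<open>P\<close> at \<open>z ^ (2 * t)\<close>.\<close>

lemma arg_add_cnj_eq_0_iff:
  assumes z: "z \<in> U"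
  shows "arg a b z + cnj (arg a b z) = 0 \<longleftrightarrow> P k a b (z ^ (2 * t)) = 0"
proof -
  \<comment> \<open>These are the negatives of \<open>d1\<close> and \<open>d2\<close> modulo
    \<open>Q + 1\<close>, hence the exponents of the conjugates of \<open>z ^ d1\<close> and
    \<open>z ^ d2\<close>.\<close>
  define e1 e2 where "e1 = (2 ^ k - 1) * t" and "e2 = (2 ^ k + 1) * t"
  have nz: "z \<noteq> 0" using U_nz[OF z] .
  have z1: "z ^ (s * (Q + 1)) = 1" for s
    using z by (simp add: U_def mult.commute[of s] power_mult del: mult_Suc mult_Suc_right)
  have shift: "s * (Q - 1) + 1 + e = s * (Q + 1)" if "2 * s = e + 1" for s e
    using that Q_ge by (cases Q) (simp_all add: algebra_simps)
  have de: "d1 + e1 = s1 * (Q + 1)" "d2 + e2 = s2 * (Q + 1)"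
    using shift[OF d1(2)] shift[OF d2(2)] by (simp_all only: d1(1) d2(1) e1_def e2_def)
  have c: "z ^ d1 * z ^ e1 = 1" "z ^ d2 * z ^ e2 = 1"
    unfolding power_add [symmetric] de by (rule z1)+
  then have cz: "cnj (z ^ d1) = z ^ e1" "cnj (z ^ d2) = z ^ e2"
    unfolding cnj_power cnj_U[OF z] using nz by (simp_all add: power_divide field_simps)
  \<comment> \<open>Removes the truncated subtraction in \<open>2 ^ k - 1\<close>.\<close>
  obtain c where "(2::nat) ^ k = Suc c" by (metis not0_implies_Suc power_not_zero zero_neq_numeral)
  then have e: "e2 = e1 + 2 * t" "e1 + e2 = 2 * t * 2 ^ k" "e2 + e2 = 2 * t * (2 ^ k + 1)"
    by (simp_all add: e1_def e2_def algebra_simps)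
  have "(arg a b z + cnj (arg a b z)) * z ^ e2 =
      a * (z ^ d1 * z ^ e2) + b * (z ^ d2 * z ^ e2) + cnj a * (z ^ e1 * z ^ e2) + cnj b * (z ^ e2 * z ^ e2)"
    by (simp only: arg_def cnj_add cnj_mult cz) (simp add: algebra_simps)
  also have "z ^ d1 * z ^ e2 = z ^ (2 * t)"
    using c(1) by (simp add: e(1) power_add flip: mult.assoc)
  also have "z ^ e1 * z ^ e2 = (z ^ (2 * t)) ^ (2 ^ k)"
    by (simp only: power_add [symmetric] e(2) power_mult)
  also have "z ^ e2 * z ^ e2 = (z ^ (2 * t)) ^ (2 ^ k + 1)"
    by (simp only: power_add [symmetric] e(3) power_mult)
  finally have "(arg a b z + cnj (arg a b z)) * z ^ e2 = P k a b (z ^ (2 * t))"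
    by (simp only: c(2) P_def mult_1_right add_ac)
  then show ?thesis using nz by auto
qed

text \<open>On the ray through \<open>z\<close> half of the \<open>Q\<close> subfield elements have
  nonzero trace, unless the relative trace of the argument vanishes at \<open>z\<close>; that
  happens for \<open>l * M p\<close> of the \<open>Q + 1\<close> rays.\<close>

lemma weight_codeword:
  "2 * hamming_weight (Q * Q - 1) (codeword p) + l * M p * Q = (Q + 1) * Q"
proof -
  let ?g = "arg (fst p) (snd p)"
  let ?f = "\<lambda>z. ?g z + cnj (?g z)"
  have "hamming_weight (Q * Q - 1) (codeword p) = card {i \<in> {..<Q * Q - 1}. Tr (?g (\<theta> ^ i)) \<noteq> 0}"
    unfolding hamming_weight_def codeword_def by (intro arg_cong[where f = card]) auto
  also have "\<dots> = card {x \<in> UNIV - {0}. Tr (?g x) \<noteq> 0}"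
    by (rule card_Collect_bij_betw[OF bij_\<theta>])
  also have "\<dots> = card {zy \<in> U \<times> (FQ - {0}). Tr (?g (case zy of (z, y) \<Rightarrow> y * z)) \<noteq> 0}"
    by (rule card_Collect_bij_betw[OF bij_polar, symmetric])
  also have "{zy \<in> U \<times> (FQ - {0}). Tr (?g (case zy of (z, y) \<Rightarrow> y * z)) \<noteq> 0} =
      (SIGMA z:U. {y \<in> FQ - {0}. tr (y * ?f z) \<noteq> 0})"
  proof -
    have "Tr (?g (y * z)) = tr (y * ?f z)" if "y \<in> FQ - {0}" for y z
      using that arg_polar[OF that] by (simp add: Tr_def distrib_left FQ_def)
    then show ?thesis by auto
  qed
  also have "card \<dots> = (\<Sum>z\<in>U. card {y \<in> FQ - {0}. tr (y * ?f z) \<noteq> 0})"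
    by (rule card_SigmaI) (simp_all add: fin)
  finally have "2 * hamming_weight (Q * Q - 1) (codeword p) = (\<Sum>z\<in>U. 2 * card {y \<in> FQ - {0}. tr (y * ?f z) \<noteq> 0})"
    by (simp add: sum_distrib_left)
  also have "\<dots> = (\<Sum>z\<in>U. if P k (fst p) (snd p) (z ^ (2 * t)) = 0 then 0 else Q)"
    by (intro sum.cong refl) (simp only: card_tr_nonzero[OF add_cnj_FQ] arg_add_cnj_eq_0_iff)
  finally have w: "2 * hamming_weight (Q * Q - 1) (codeword p) = \<dots>" .
  have "l * M p * Q = (\<Sum>z\<in>U. if P k (fst p) (snd p) (z ^ (2 * t)) = 0 then Q else 0)"
    unfolding M_def card_U_power [symmetric] using fin[of U] by (simp add: sum.If_cases Int_def)
  then have "2 * hamming_weight (Q * Q - 1) (codeword p) + l * M p * Q = (\<Sum>z\<in>U. Q)"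
    unfolding w by (simp only: sum.distrib [symmetric]) (intro sum.cong; simp)
  then show ?thesis by (simp add: card_U)
qed

lemma M_zero: "M (0, 0) = v"
  by (simp add: M_def P_def card_V)

lemma M_le: "p \<noteq> (0, 0) \<Longrightarrow> M p \<le> 3"
  unfolding M_def using card_zeros_le_3[OF cop k V_sub_U, of "fst p" "snd p"] by auto

lemma sum_choose_M: "r \<le> 3 \<Longrightarrow> (\<Sum>p\<in>UNIV. M p choose r) = (v choose r) * Q ^ (4 - r)"
  unfolding M_def using sum_choose_zeros[OF V_sub_U, of r k] by (simp add: card_V)

end

section \<open>Binary cyclic codes and their duals\<close>

text \<open>A new basis vector adds one disjoint translate and so doubles the span.\<close>

lemma card_bin_span:
  assumes "finite B" "bin.independent B"
  shows "finite (bin.span B) \<and> card (bin.span B) = 2 ^ card B"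
  using assms
proof (induction B rule: finite_induct)
  case (insert b B)
  have ind: "b \<notin> bin.span B" "bin.independent B"
    using insert.prems insert.hyps by (simp_all add: bin.independent_insert)
  have bit_ex: "(\<exists>c::bit. R c) \<longleftrightarrow> R 0 \<or> R 1" for R by (metis bit_not_zero_iff)
  have "bin.span (insert b B) = bin.span B \<union> (\<lambda>x. x + b) ` bin.span B"
  proof -
    have "x - b \<in> bin.span B \<longleftrightarrow> x \<in> (\<lambda>x. x + b) ` bin.span B" for x
      by (auto intro: image_eqI[of _ _ "x - b"])
    then show ?thesis
      by (auto simp: bin.span_insert bit_ex)
  qed
  moreover have "bin.span B \<inter> (\<lambda>x. x + b) ` bin.span B = {}"
    using ind(1) bin.span_add_eq by blast
  moreover have "card ((\<lambda>x. x + b) ` bin.span B) = card (bin.span B)"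
    by (rule card_image) simp
  ultimately show ?case
    using insert.IH[OF ind(2)] insert.hyps by (simp add: card_Un_disjoint)
qed simp

lemma card_bin_subspace:
  assumes "bin.subspace C" "finite C"
  shows "card C = 2 ^ bin.dim C"
proof -
  obtain B where B: "B \<subseteq> C" "bin.independent B" "C \<subseteq> bin.span B" "card B = bin.dim C"
    using bin.basis_exists by blast
  have "bin.span B = C"
    using B(1,3) assms(1) by (metis bin.span_minimal subset_antisym)
  then show ?thesis
    using card_bin_span[OF finite_subset[OF B(1) assms(2)] B(2)] B(4) by simp
qed

lemma word_poly_coeff:
  assumes "degree f < N"
  shows "word_poly N (coeff f) = f"
  unfolding word_poly_def using assms poly_as_sum_of_monoms'[of f "N - 1"]
  by (cases N) (simp_all add: lessThan_Suc_atMost)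

lemma coeff_in_words: "degree f < N \<Longrightarrow> coeff f \<in> words N"
  by (auto simp: words_def coeff_eq_0)

text \<open>A word of the dual satisfies the linear recurrence with characteristic polynomial \<open>g\<close>.\<close>

lemma card_dual_cyclic_code_le:
  assumes "lead_coeff g = 1"
  shows "finite (dual_code N (cyclic_code N g)) \<and> card (dual_code N (cyclic_code N g)) \<le> 2 ^ degree g"
proof -
  let ?D = "dual_code N (cyclic_code N g)" and ?d = "degree g"
  have g0: "g \<noteq> 0" using assms by auto
  have eq: "v i = w i" if v: "v \<in> ?D" and w: "w \<in> ?D" and init: "\<And>i. i < ?d \<Longrightarrow> v i = w i" for v w i
  proof (induction i rule: less_induct)
    case (less i)
    consider "i < ?d" | "N \<le> i" | "?d \<le> i" "i < N" by linarith
    then show ?case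
    proof cases
      case 1 then show ?thesis by (rule init)
    next
      case 2 then show ?thesis using v w by (simp add: dual_code_def words_def)
    next
      case 3
      \<comment> \<open>A shift of \<open>g\<close> with leading position \<open>i\<close>;
        orthogonality to it determines entry \<open>i\<close> from the earlier ones.\<close>
      define f where "f = monom 1 (i - ?d) * g"
      have f: "degree f = i" "coeff f i = 1"
        using 3 assms g0 unfolding f_def by (simp_all add: degree_mult_eq degree_monom_eq coeff_monom_mult)
      have "coeff f \<in> cyclic_code N g"
      proof -
        have "word_poly N (coeff f) = monom 1 (i - ?d) * g"
          using 3 f(1) word_poly_coeff[of f N] by (simp add: f_def)
        then have "\<exists>h. [word_poly N (coeff f) = h * g] (mod (monom 1 N - 1))"
          by (intro exI[of _ "monom 1 (i - ?d)"]) (simp only: cong_refl)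
        then show ?thesis
          using 3 f(1) coeff_in_words[of f N] unfolding cyclic_code_def by blast
      qed
      then have dot: "(\<Sum>j<N. x j * coeff f j) = 0" if "x \<in> ?D" for x
        using that by (simp add: dual_code_def)
      have split: "(\<Sum>j<N. x j * coeff f j) = (\<Sum>j<i. x j * coeff f j) + x i" for x :: bin_word
      proof -
        have "(\<Sum>j<N. x j * coeff f j) = (\<Sum>j\<in>{..<Suc i}. x j * coeff f j)"
          using 3 f(1) by (intro sum.mono_neutral_right) (auto simp: coeff_eq_0)
        then show ?thesis using f(2) by simp
      qed
      have "(\<Sum>j<i. v j * coeff f j) = (\<Sum>j<i. w j * coeff f j)"
        using less by simp
      then show ?thesis using dot[OF v] dot[OF w] unfolding split by (metis add_left_cancel)
    qed
  qed
  \<comment> \<open>The initial segment of length \<open>?d\<close>, encoded as its support.\<close>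
  let ?F = "\<lambda>v. {i. i < ?d \<and> v i = (1::bit)}"
  have "inj_on ?F ?D"
  proof (rule inj_onI)
    fix v w assume vw: "v \<in> ?D" "w \<in> ?D" "?F v = ?F w"
    have "v i = w i" if "i < ?d" for i
    proof -
      have "i \<in> ?F v \<longleftrightarrow> i \<in> ?F w" by (simp only: vw(3))
      then show ?thesis using that by (cases "v i"; cases "w i") simp_all
    qed
    then show "v = w" using eq[OF vw(1,2)] by blast
  qed
  moreover have "?F ` ?D \<subseteq> Pow {..<?d}" by auto
  moreover have "finite (Pow {..<?d})" by simp
  ultimately have "finite ?D" "card ?D \<le> card (Pow {..<?d})"
    using inj_on_finite[of ?F ?D "Pow {..<?d}"] card_inj_on_le[of ?F ?D "Pow {..<?d}"] by blast+
  then show ?thesis by (simp add: card_Pow)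
qed

section \<open>Evaluation of binary polynomials in characteristic 2\<close>

definition ev :: "'a::field \<Rightarrow> bit poly \<Rightarrow> 'a" where
  "ev \<alpha> f = poly (map_poly of_bit f) \<alpha>"

context
  assumes two: "(2::'a::field) = 0"
begin

lemma ev_add: "ev (\<alpha>::'a) (f + g) = ev \<alpha> f + ev \<alpha> g"
  unfolding ev_def by (rule poly_of_bit_add_char2[OF two])

lemma ev_diff: "ev (\<alpha>::'a) (f - g) = ev \<alpha> f - ev \<alpha> g"
  using ev_add[of \<alpha> "f - g" g] by simp

lemma ev_0 [simp]: "ev (\<alpha>::'a) 0 = 0"
  by (simp add: ev_def)

lemma ev_1: "ev (\<alpha>::'a) 1 = 1"
  by (simp add: ev_def)

lemma ev_sum: "ev (\<alpha>::'a) (\<Sum>i\<in>A. f i) = (\<Sum>i\<in>A. ev \<alpha> (f i))"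
  by (induction A rule: infinite_finite_induct) (simp_all add: ev_add)

lemma ev_monom: "ev (\<alpha>::'a) (monom c n) = of_bit c * \<alpha> ^ n"
  by (simp add: ev_def map_poly_monom poly_monom)

lemma ev_pCons: "ev (\<alpha>::'a) (pCons c f) = of_bit c + \<alpha> * ev \<alpha> f"
  by (cases "c = 0 \<and> f = 0") (auto simp: ev_def map_poly_pCons)

lemma ev_mult: "ev (\<alpha>::'a) (f * g) = ev \<alpha> f * ev \<alpha> g"
proof (induction f)
  case (pCons c f)
  have "ev \<alpha> (smult c g) = of_bit c * ev \<alpha> g"
    by (cases c) simp_all
  then show ?case
    by (simp add: ev_add ev_pCons pCons algebra_simps)
qed simp

lemma ev_word_poly: "ev (\<alpha>::'a) (word_poly N w) = (\<Sum>i<N. of_bit (w i) * \<alpha> ^ i)"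
  by (simp add: word_poly_def ev_sum ev_monom)

text \<open>At \<open>\<alpha>\<close> both the multiple of \<open>g\<close> and the modulus
  \<open>monom 1 N - 1\<close> vanish.\<close>

lemma ev_cyclic_code:
  assumes "w \<in> cyclic_code N g" "ev (\<alpha>::'a) g = 0" "\<alpha> ^ N = 1"
  shows "ev \<alpha> (word_poly N w) = 0"
proof -
  obtain h where "[word_poly N w = h * g] (mod (monom 1 N - 1))"
    using assms(1) by (auto simp: cyclic_code_def)
  then obtain r where "word_poly N w - h * g = (monom 1 N - 1) * r"
    by (auto simp: cong_iff_dvd_diff dvd_def)
  then have "ev \<alpha> (word_poly N w) - ev \<alpha> (h * g) = ev \<alpha> (monom 1 N - 1) * ev \<alpha> r"
    by (simp flip: ev_diff ev_mult)
  then show ?thesis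
    using assms(2,3) by (simp add: ev_diff ev_mult ev_monom ev_1)
qed

lemma of_bit_sum: "(of_bit (\<Sum>i\<in>A. f i) :: 'a) = (\<Sum>i\<in>A. of_bit (f i))"
proof (induction A rule: infinite_finite_induct)
  case (insert x A)
  show ?case
    unfolding sum.insert[OF insert.hyps] of_bit_add_char2[OF two] insert.IH ..
qed simp_all

end

text \<open>Pigeonhole: among the \<open>2 ^ (n + 1)\<close> subset sums of the powers of
  \<open>\<alpha>\<close> up to exponent \<open>n\<close> two coincide, and their difference is an
  annihilating polynomial.\<close>

lemma degree_min_poly_le:
  fixes \<alpha> :: "'a::field"
  assumes card: "CARD('a) = 2 ^ n"
  shows "degree (min_poly \<alpha>) \<le> n"
proof -
  note two = two_eq_zero_of_card[OF card]
  have fin: "finite (UNIV :: 'a set)"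
    using card by (metis card.infinite power_not_zero zero_neq_numeral)
  let ?f = "\<lambda>S. (\<Sum>i\<in>S. \<alpha> ^ i)"
  have "\<not> inj_on ?f (Pow {..n})"
  proof
    assume "inj_on ?f (Pow {..n})"
    then have "card (Pow {..n}) \<le> CARD('a)"
      using fin by (metis card_inj_on_le subset_UNIV)
    then show False by (simp add: card_Pow card)
  qed
  then obtain S T where ST: "S \<subseteq> {..n}" "T \<subseteq> {..n}" "S \<noteq> T" "?f S = ?f T"
    by (auto simp: inj_on_def)
  define s :: "nat set \<Rightarrow> bit poly" where "s S = (\<Sum>i\<in>S. monom 1 i)" for S
  have coeff_s: "coeff (s S) i = (if i \<in> S then 1 else 0)" if "S \<subseteq> {..n}" for S i
    using finite_subset[OF that] by (simp add: s_def coeff_sum if_distrib sum.delta)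
  have deg: "degree (s S) \<le> n" if "S \<subseteq> {..n}" for S
    using that by (intro degree_le) (auto simp: coeff_s)
  obtain i where "(i \<in> S) \<noteq> (i \<in> T)" using ST(3) by blast
  then have "coeff (s S) i \<noteq> coeff (s T) i" using coeff_s ST by auto
  then have "s S - s T \<noteq> 0" by auto
  moreover have "poly (map_poly of_bit (s S - s T)) \<alpha> = 0"
    unfolding ev_def [symmetric] ev_diff[OF two] s_def ev_sum[OF two] ev_monom[OF two]
    using ST(4) by simp
  ultimately have "degree (min_poly \<alpha>) \<le> degree (s S - s T)"
    using is_min_poly_min_poly[OF card, of \<alpha>] by (simp add: is_min_poly_def)
  also have "\<dots> \<le> n" using deg ST by (simp add: degree_diff_le)
  finally show ?thesis .
qed

section \<open>The weight distribution\<close>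

context quadratic_extension begin

lemma Tr_sum: "Tr (\<Sum>i\<in>A. f i) = (\<Sum>i\<in>A. Tr (f i))"
  by (induction A rule: infinite_finite_induct) (simp_all add: Tr_add)

lemma Tr_of_bit: "Tr (x * of_bit c) = Tr x * of_bit c"
  by (cases c) simp_all

lemma power_card_minus_1: "x \<noteq> 0 \<Longrightarrow> (x::'a) ^ (Q * Q - 1) = 1"
  unfolding order_factor diff_Suc_1 by (rule power_order)

end

section \<open>Identification of the dual code with the trace words\<close>

context niho_pair begin

lemma arg_add: "arg (a + a') (b + b') x = arg a b x + arg a' b' x"
  by (simp add: arg_def algebra_simps)

lemma of_bit_codeword:
  "i < Q * Q - 1 \<Longrightarrow> of_bit (codeword p i) = Tr (arg (fst p) (snd p) (\<theta> ^ i))"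
  using Tr_cases[of "arg (fst p) (snd p) (\<theta> ^ i)"] by (auto simp: codeword_def)

lemma codeword_add: "codeword (p + p') = codeword p + codeword p'"
proof
  fix i
  have "Tr (arg (fst (p + p')) (snd (p + p')) (\<theta> ^ i)) =
      Tr (arg (fst p) (snd p) (\<theta> ^ i)) + Tr (arg (fst p') (snd p') (\<theta> ^ i))"
    by (simp add: arg_add Tr_add)
  then show "codeword (p + p') i = (codeword p + codeword p') i"
    using Tr_cases[of "arg (fst p) (snd p) (\<theta> ^ i)"] Tr_cases[of "arg (fst p') (snd p') (\<theta> ^ i)"]
    by (auto simp: codeword_def two)
qed

lemma codeword_0: "codeword 0 = 0"
  by (simp add: codeword_def fun_eq_iff arg_def)

text \<open>Weight zero would force \<open>M p = v\<close>, whereas \<open>M p \<le> 3\<close> and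
  \<open>5 \<le> v\<close>.\<close>

lemma weight_codeword_pos:
  assumes "p \<noteq> 0"
  shows "0 < hamming_weight (Q * Q - 1) (codeword p)"
proof (rule ccontr)
  assume "\<not> ?thesis"
  then have "l * M p * Q = (Q + 1) * Q" using weight_codeword[of p] by simp
  then have "l * M p * Q = l * v * Q" by (simp only: lv)
  then have "M p = v \<or> l = 0" using Q_ge by simp
  moreover have "M p \<le> 3" using M_le[of p] assms by (simp add: zero_prod_def)
  ultimately show False using lv v by auto
qed

lemma inj_codeword: "inj codeword"
proof (rule injI)
  fix p p' assume "codeword p = codeword p'"
  then have "codeword (p + p') = 0"
    by (simp add: codeword_add fun_eq_iff)
  then have "hamming_weight (Q * Q - 1) (codeword (p + p')) = 0"
    by (simp add: hamming_weight_def)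
  then have "p + p' = 0" using weight_codeword_pos by (metis less_irrefl)
  then show "p = p'" by (auto simp: prod_eq_iff add_eq_0)
qed

abbreviation code :: "bin_word set" where
  "code \<equiv> dual_code (Q * Q - 1) (cyclic_code2 (Q * Q) \<theta> d1 d2)"

text \<open>The inner product with \<open>w\<close> is the trace of \<open>a\<close> times the value
  of the word polynomial at \<open>\<theta> ^ d1\<close> plus \<open>b\<close> times its value at
  \<open>\<theta> ^ d2\<close>; both are roots of the generator.\<close>

lemma codeword_in_code: "codeword p \<in> code"
proof -
  define a b where "a = fst p" and "b = snd p"
  have "(\<Sum>i<Q * Q - 1. codeword p i * w i) = 0" if w: "w \<in> cyclic_code2 (Q * Q) \<theta> d1 d2" for w
  proof -
    have root: "ev \<alpha> (min_poly \<alpha>) = 0" for \<alpha> :: 'a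
      using is_min_poly_min_poly[of "m + m" \<alpha>] card_field
      by (simp add: is_min_poly_def ev_def Q power_add)
    have w0: "ev (\<theta> ^ d) (word_poly (Q * Q - 1) w) = 0" if "d \<in> {d1, d2}" for d
    proof (rule ev_cyclic_code[OF two])
      show "w \<in> cyclic_code (Q * Q - 1) (min_poly (\<theta> ^ d1) * min_poly (\<theta> ^ d2))"
        using w by (simp add: cyclic_code2_def)
      show "ev (\<theta> ^ d) (min_poly (\<theta> ^ d1) * min_poly (\<theta> ^ d2)) = 0"
        using that root by (auto simp: ev_mult[OF two])
    qed (rule power_card_minus_1, simp add: \<theta>_nz)
    have "of_bit (\<Sum>i<Q * Q - 1. codeword p i * w i) = (\<Sum>i<Q * Q - 1. of_bit (codeword p i * w i) :: 'a)"
      by (rule of_bit_sum[OF two])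
    also have "\<dots> = (\<Sum>i<Q * Q - 1. Tr (arg a b (\<theta> ^ i) * of_bit (w i)))"
    proof (rule sum.cong[OF refl])
      fix i assume "i \<in> {..<Q * Q - 1}"
      then have "of_bit (codeword p i) = Tr (arg a b (\<theta> ^ i))"
        using of_bit_codeword by (simp add: a_def b_def)
      then show "of_bit (codeword p i * w i) = Tr (arg a b (\<theta> ^ i) * of_bit (w i))"
        unfolding Tr_of_bit by (cases "w i") simp_all
    qed
    also have "\<dots> = Tr (\<Sum>i<Q * Q - 1. arg a b (\<theta> ^ i) * of_bit (w i))"
      by (rule Tr_sum [symmetric])
    also have "(\<Sum>i<Q * Q - 1. arg a b (\<theta> ^ i) * of_bit (w i)) =
        (\<Sum>i<Q * Q - 1. a * (of_bit (w i) * (\<theta> ^ d1) ^ i) + b * (of_bit (w i) * (\<theta> ^ d2) ^ i))"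
    proof (rule sum.cong[OF refl])
      fix i
      have "(\<theta> ^ i) ^ d = (\<theta> ^ d) ^ i" for d by (simp only: power_mult [symmetric] mult.commute)
      then show "arg a b (\<theta> ^ i) * of_bit (w i) =
          a * (of_bit (w i) * (\<theta> ^ d1) ^ i) + b * (of_bit (w i) * (\<theta> ^ d2) ^ i)"
        by (simp only: arg_def) (simp add: algebra_simps)
    qed
    also have "\<dots> = 0"
      using w0[of d1] w0[of d2]
      by (simp only: sum.distrib sum_distrib_left [symmetric] ev_word_poly[OF two, symmetric] insert_iff simp_thms mult_zero_right add_0_left)
    finally have "(of_bit (\<Sum>i<Q * Q - 1. codeword p i * w i) :: 'a) = 0" by simp
    then show ?thesis by (cases "\<Sum>i<Q * Q - 1. codeword p i * w i") simp_all
  qed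
  moreover have "codeword p \<in> words (Q * Q - 1)" by (simp add: words_def codeword_def)
  ultimately show ?thesis unfolding dual_code_def by blast
qed

lemma card_range_codeword: "card (range codeword) = 2 ^ (4 * m)"
proof -
  have "card (UNIV :: ('a \<times> 'a) set) = (Q * Q) * (Q * Q)"
    by (simp add: card_field card_cartesian_product flip: UNIV_Times_UNIV)
  also have "\<dots> = 2 ^ (4 * m)"
    by (simp add: Q flip: power_add)
  finally show ?thesis
    by (simp only: card_image[OF inj_codeword])
qed

text \<open>A counting squeeze: the code contains \<open>2 ^ (4 * m)\<close> distinct trace words,
  while its size is at most 2 to the degree of the generator, which is at most
  \<open>4 * m\<close>.\<close>

lemma code_eq: "code = range codeword" and finite_code: "finite code"
proof -
  have card': "CARD('a) = 2 ^ (2 * m)" by (simp add: card_field Q mult_2 power_add)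
  let ?g = "min_poly (\<theta> ^ d1) * min_poly (\<theta> ^ d2)"
  have monic: "lead_coeff (min_poly \<alpha>) = 1" for \<alpha> :: 'a
    using is_min_poly_min_poly[OF card', of \<alpha>] by (simp add: is_min_poly_def)
  have "degree ?g \<le> 4 * m"
    using degree_mult_le[of "min_poly (\<theta> ^ d1)" "min_poly (\<theta> ^ d2)"]
      degree_min_poly_le[OF card', of "\<theta> ^ d1"] degree_min_poly_le[OF card', of "\<theta> ^ d2"] by linarith
  moreover have "lead_coeff ?g = 1" unfolding lead_coeff_mult monic by simp
  note dual = card_dual_cyclic_code_le[OF this, of "Q * Q - 1"]
  ultimately have le: "card code \<le> 2 ^ (4 * m)"
    using order_trans[OF conjunct2[OF dual] power_increasing[of "degree ?g" "4 * m" 2]]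
    by (simp add: cyclic_code2_def)
  show fin': "finite code" using dual by (simp add: cyclic_code2_def)
  have "range codeword \<subseteq> code" using codeword_in_code by blast
  then show "code = range codeword"
    using card_seteq[OF fin'] le card_range_codeword by metis
qed

lemma linear_code_code: "linear_code (Q * Q - 1) (4 * m) code"
proof -
  have "bin.subspace (range codeword)"
  proof (rule bin.subspaceI)
    show "0 \<in> range codeword" unfolding codeword_0 [symmetric] by (rule rangeI)
    show "x + y \<in> range codeword" if "x \<in> range codeword" "y \<in> range codeword" for x y
      using that by (auto simp flip: codeword_add)
    show "word_scale c x \<in> range codeword" if "x \<in> range codeword" for c x
    proof (cases "c = 0")
      case True
      then have "word_scale c x = codeword 0" by (simp add: word_scale_def codeword_0 fun_eq_iff)
      then show ?thesis by simp
    next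
      case False
      then have "word_scale c x = x" using bin.scale_one[of x] by simp
      then show ?thesis using that by simp
    qed
  qed
  then have sub: "bin.subspace code" unfolding code_eq .
  have "(2::nat) ^ bin.dim code = 2 ^ (4 * m)"
    using card_bin_subspace[OF sub finite_code] card_range_codeword code_eq by simp
  then have "bin.dim code = 4 * m" by simp
  moreover have "code \<subseteq> words (Q * Q - 1)" by (auto simp: dual_code_def)
  ultimately show ?thesis using sub by (simp add: linear_code_def)
qed

section \<open>Weights, their frequencies and the minimum distance\<close>

definition W :: "int \<Rightarrow> int" where
  "W j = 2 ^ (2 * m - 1) - (j * int l - 1) * 2 ^ (m - 1)"

lemma l_pos: "0 < l"
  using lv by (cases l) auto

lemma W_less_iff: "W i < W j \<longleftrightarrow> j < i"
  using l_pos by (simp add: W_def)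

lemma W_eq_iff: "W i = W j \<longleftrightarrow> i = j"
  using l_pos by (simp add: W_def)

lemma hamming_weight_codeword: "int (hamming_weight (Q * Q - 1) (codeword p)) = W (int (M p))"
proof -
  define h where "h = (2::int) ^ (m - 1)"
  have Q2: "int Q = 2 * h" using m by (cases m) (simp_all add: Q h_def)
  have "(2::int) ^ (2 * m - 1) = 2 ^ m * 2 ^ (m - 1)"
    using m by (subst power_add [symmetric], intro arg_cong[where f = "power 2"]) simp
  then have W: "W j = int Q * h - (j * int l - 1) * h" for j by (simp add: W_def h_def Q)
  have "int (2 * hamming_weight (Q * Q - 1) (codeword p) + l * M p * Q) = int ((Q + 1) * Q)"
    by (simp only: weight_codeword)
  then show ?thesis
    unfolding W by (simp add: Q2 of_nat_mult of_nat_add) (simp add: algebra_simps)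
qed

definition A :: "nat \<Rightarrow> nat" where "A j = card {p. M p = j}"

lemma M_eq: "M p = j \<Longrightarrow> j \<le> 3 \<Longrightarrow> p \<noteq> 0"
  using M_zero v by (auto simp: zero_prod_def)

text \<open>The zero pair is split off as the term \<open>v choose r\<close>; the other pairs are
  grouped by their number of zeros, which is at most 3.\<close>

lemma moment:
  assumes "r \<le> 3"
  shows "(v choose r) + (\<Sum>j\<le>3. A j * (j choose r)) = (v choose r) * Q ^ (4 - r)"
proof -
  have fin': "finite (UNIV :: ('a \<times> 'a) set)"
    unfolding UNIV_Times_UNIV [symmetric] by (intro finite_cartesian_product fin)
  have img: "M ` (UNIV - {0}) \<subseteq> {..3}"
    using M_le by (auto simp: zero_prod_def)
  have "(\<Sum>p\<in>UNIV. M p choose r) = (M 0 choose r) + (\<Sum>p\<in>UNIV - {0}. M p choose r)"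
    by (rule sum.remove[OF fin' UNIV_I])
  also have "(\<Sum>p\<in>UNIV - {0}. M p choose r) = (\<Sum>j\<le>3. \<Sum>p\<in>{p \<in> UNIV - {0}. M p = j}. M p choose r)"
    using img by (intro sum.group[symmetric]) (simp_all add: fin')
  also have "\<dots> = (\<Sum>j\<le>3. A j * (j choose r))"
  proof (rule sum.cong[OF refl])
    fix j :: nat assume j: "j \<in> {..3}"
    have "{p \<in> UNIV - {0}. M p = j} = {p. M p = j}"
      using M_eq[of _ j] j by auto
    then show "(\<Sum>p\<in>{p \<in> UNIV - {0}. M p = j}. M p choose r) = A j * (j choose r)"
      by (simp add: A_def)
  qed
  finally show ?thesis
    using sum_choose_M[OF assms] M_zero by (simp add: zero_prod_def)
qed

lemma v_le: "v \<le> Q + 1"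
  using lv l_pos by simp

lemma moments_real:
  "1 + (real (A 0) + real (A 1) + real (A 2) + real (A 3)) = real Q ^ 4"
  "real v + (real (A 1) + 2 * real (A 2) + 3 * real (A 3)) = real v * real Q ^ 3"
  "real (v choose 2) + (real (A 2) + 3 * real (A 3)) = real (v choose 2) * real Q ^ 2"
  "real (v choose 3) + real (A 3) = real (v choose 3) * real Q"
proof -
  have atMost_3: "(\<Sum>j\<le>3. f j) = f 0 + f 1 + f 2 + f 3" for f :: "nat \<Rightarrow> nat"
    by (simp add: eval_nat_numeral)
  have choose: "3 choose 2 = (3::nat)" "2 choose 3 = (0::nat)" "Suc 0 choose 2 = (0::nat)" "Suc 0 choose 3 = (0::nat)"
    "0 choose 2 = (0::nat)" "0 choose 3 = (0::nat)"
    by (simp_all add: eval_nat_numeral)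
  have eq: "real (v choose r) + (real (A 0) * real (0 choose r) + real (A 1) * real (1 choose r)
      + real (A 2) * real (2 choose r) + real (A 3) * real (3 choose r)) = real (v choose r) * real Q ^ (4 - r)"
    if "r \<le> 3" for r
    using arg_cong[OF moment[OF that], of real] unfolding atMost_3 by simp
  show "1 + (real (A 0) + real (A 1) + real (A 2) + real (A 3)) = real Q ^ 4" using eq[of 0] by simp
  show "real v + (real (A 1) + 2 * real (A 2) + 3 * real (A 3)) = real v * real Q ^ 3"
    using eq[of 1] by simp
  show "real (v choose 2) + (real (A 2) + 3 * real (A 3)) = real (v choose 2) * real Q ^ 2"
    using eq[of 2] by (simp add: choose)
  show "real (v choose 3) + real (A 3) = real (v choose 3) * real Q"
    using eq[of 3] by (simp add: choose)
qed

lemmas counts = binomial_moments_solve[OF moments_real real_choose_2_3]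

lemma counts_pos: "j \<le> 3 \<Longrightarrow> 0 < A j"
proof -
  have "real v \<ge> 5" "real v \<le> real Q + 1" using v v_le by simp_all
  note pos = binomial_moments_pos[OF counts this]
  assume "j \<le> 3"
  then consider "j = 0" | "j = 1" | "j = 2" | "j = 3" by linarith
  then show ?thesis using pos by cases simp_all
qed
lemma weight_count_W:
  assumes "j \<le> 3"
  shows "weight_count (Q * Q - 1) code (W (int j)) = A j"
proof -
  have "{w \<in> code. int (hamming_weight (Q * Q - 1) w) = W (int j)} = codeword ` {p. M p = j}"
    unfolding code_eq by (auto simp: hamming_weight_codeword W_eq_iff simp del: One_nat_def)
  then show ?thesis
    by (simp add: weight_count_def A_def card_image[OF inj_on_subset[OF inj_codeword]])
qed

lemma hamming_weight_0: "hamming_weight N 0 = 0"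
  by (simp add: hamming_weight_def)

lemma hamming_weight_codeword_eq_0_iff:
  "hamming_weight (Q * Q - 1) (codeword p) = 0 \<longleftrightarrow> p = 0"
  using weight_codeword_pos[of p] codeword_0 hamming_weight_0[of "Q * Q - 1"] by (cases "p = 0") auto

lemma weight_count_0: "weight_count (Q * Q - 1) code 0 = 1"
proof -
  have "{w \<in> code. int (hamming_weight (Q * Q - 1) w) = 0} = {codeword 0}"
    unfolding code_eq by (auto simp: hamming_weight_codeword_eq_0_iff simp del: One_nat_def)
  then show ?thesis by (simp add: weight_count_def)
qed

lemma weights: "int ` hamming_weight (Q * Q - 1) ` code = {0, W 3, W 2, W 1, W 0}"
proof
  show "int ` hamming_weight (Q * Q - 1) ` code \<subseteq> {0, W 3, W 2, W 1, W 0}"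
  proof
    fix x assume "x \<in> int ` hamming_weight (Q * Q - 1) ` code"
    then obtain p where p: "x = int (hamming_weight (Q * Q - 1) (codeword p))"
      unfolding code_eq by blast
    show "x \<in> {0, W 3, W 2, W 1, W 0}"
    proof (cases "p = 0")
      case True
      then have "x = 0" using hamming_weight_codeword_eq_0_iff[of p] p by simp
      then show ?thesis by simp
    next
      case False
      then have "M p \<le> 3" using M_le by (simp add: zero_prod_def)
      then consider "M p = 0" | "M p = 1" | "M p = 2" | "M p = 3" by linarith
      then show ?thesis unfolding p hamming_weight_codeword by cases simp_all
    qed
  qed
  have "W (int j) \<in> int ` hamming_weight (Q * Q - 1) ` code" if "j \<le> 3" for j
  proof -
    have "{p. M p = j} \<noteq> {}" using counts_pos[OF that] unfolding A_def by (metis card.empty less_irrefl)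
    then obtain p where "M p = j" by blast
    then show ?thesis unfolding code_eq by (metis hamming_weight_codeword imageI rangeI)
  qed
  from this[of 0] this[of 1] this[of 2] this[of 3]
  have "{W 3, W 2, W 1, W 0} \<subseteq> int ` hamming_weight (Q * Q - 1) ` code" by simp
  moreover have "0 \<in> int ` hamming_weight (Q * Q - 1) ` code"
    unfolding code_eq by (metis codeword_0 hamming_weight_0 image_eqI of_nat_0 rangeI)
  ultimately show "{0, W 3, W 2, W 1, W 0} \<subseteq> int ` hamming_weight (Q * Q - 1) ` code" by simp
qed

text \<open>Distances are weights of sums of codewords, and \<open>W\<close> is strictly decreasing,
  so a pair with the maximal number 3 of zeros attains the minimum.\<close>

lemma min_distance_code: "int (min_distance (Q * Q - 1) code) = W 3"
proof -
  let ?D = "{hamming_distance (Q * Q - 1) u w |u w. u \<in> code \<and> w \<in> code \<and> u \<noteq> w}"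
  have dist: "hamming_distance (Q * Q - 1) (codeword p) (codeword p') = hamming_weight (Q * Q - 1) (codeword (p + p'))" for p p'
  proof -
    have "x \<noteq> y \<longleftrightarrow> x + y \<noteq> 0" for x y :: bit by (cases x; cases y) simp_all
    then show ?thesis
      unfolding hamming_distance_def hamming_weight_def codeword_add plus_fun_apply by presburger
  qed
  obtain p where p: "M p = 3" using counts_pos[of 3] unfolding A_def by (metis (mono_tags, lifting) card.empty empty_Collect_eq less_irrefl order_refl)
  have "Min ?D = hamming_weight (Q * Q - 1) (codeword p)"
  proof (rule Min_eqI)
    have "finite {hamming_distance (Q * Q - 1) u w |u w. u \<in> code \<and> w \<in> code}"
      by (intro finite_image_set2) (simp_all only: finite_code Collect_mem_eq)
    then show "finite ?D" by (rule rev_finite_subset) blast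
    have "codeword p \<noteq> codeword 0" using M_eq[OF p] by (simp add: inj_eq[OF inj_codeword])
    then have "hamming_distance (Q * Q - 1) (codeword p) (codeword 0) \<in> ?D"
      using codeword_in_code by blast
    then show "hamming_weight (Q * Q - 1) (codeword p) \<in> ?D"
      by (simp only: dist add_0_right)
  next
    fix y assume "y \<in> ?D"
    then obtain p1 p2 where *: "codeword p1 \<noteq> codeword p2" "y = hamming_distance (Q * Q - 1) (codeword p1) (codeword p2)"
      unfolding code_eq by blast
    then have "p1 \<noteq> p2" by blast
    then have "p1 + p2 \<noteq> 0" by (auto simp: prod_eq_iff add_eq_0)
    then have "M (p1 + p2) \<le> M p" using M_le p by (simp add: zero_prod_def)
    then have "W (int (M p)) \<le> W (int (M (p1 + p2)))" using W_less_iff by (metis linorder_not_less of_nat_le_iff)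
    then show "hamming_weight (Q * Q - 1) (codeword p) \<le> y"
      unfolding hamming_weight_codeword [symmetric] *(2) dist by simp
  qed
  then show ?thesis unfolding min_distance_def using hamming_weight_codeword[of p] p by simp
qed

lemmas counts_real = counts_closed_form[OF counts]

end

theorem theorem13:
  fixes \<theta> :: "'a::field"
    and m n q k t s1 s2 d1 d2 l :: nat
    and C :: "bin_word set"
  assumes "m \<ge> 2" and "n = 2 * m" and "q = 2 ^ n"
    and "CARD('a) = q" and "primitive_element \<theta>"
    and "1 \<le> k" and "k \<le> m"
    and "odd t" and "1 \<le> t" and "t \<le> 2 ^ m + 1"
    and "s1 = 2 ^ (k - 1) * t - (t - 1) div 2"
    and "s2 = 2 ^ (k - 1) * t + (t + 1) div 2"
    and "d1 = s1 * (2 ^ m - 1) + 1"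
    and "d2 = s2 * (2 ^ m - 1) + 1"
    and "\<not> [(2 ^ k - 1) * t = 0] (mod (2 ^ m + 1))"
    and "\<not> [(2 ^ k + 1) * t = 0] (mod (2 ^ m + 1))"
    and "l = gcd t (2 ^ m + 1)"
    and "[int m = -1] (mod int k) \<or> gcd k (2 * m) = 1"
    and "C = dual_code (q - 1) (cyclic_code2 q \<theta> d1 d2)"
  shows "linear_code (2 ^ n - 1) (4 * m) C \<and>
      int (min_distance (2 ^ n - 1) C) = 2 ^ (2 * m - 1) - (3 * int l - 1) * 2 ^ (m - 1) \<and>
      int ` hamming_weight (2 ^ n - 1) ` C =
           {0,
            2 ^ (2 * m - 1) - (3 * int l - 1) * 2 ^ (m - 1),
            2 ^ (2 * m - 1) - (2 * int l - 1) * 2 ^ (m - 1),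
            2 ^ (2 * m - 1) - (int l - 1) * 2 ^ (m - 1),
            2 ^ (2 * m - 1) + 2 ^ (m - 1)} \<and>
      weight_count (2 ^ n - 1) C 0 = 1 \<and>
      real (weight_count (2 ^ n - 1) C (2 ^ (2 * m - 1) - (3 * int l - 1) * 2 ^ (m - 1))) =
           (2 ^ (2 * m) - 1) * (2 ^ m + 1 - 2 * real l) * (2 ^ m + 1 - real l) / (6 * real l ^ 3) \<and>
      real (weight_count (2 ^ n - 1) C (2 ^ (2 * m - 1) - (2 * int l - 1) * 2 ^ (m - 1))) =
           (2 ^ (2 * m) - 1) * ((2 ^ m + 3) * real l - 2 ^ m - 1) * (2 ^ m + 1 - real l) / (2 * real l ^ 3) \<and>
      real (weight_count (2 ^ n - 1) C (2 ^ (2 * m - 1) - (int l - 1) * 2 ^ (m - 1))) =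
           (2 ^ (2 * m) - 1) *
             ((2 ^ (2 * m + 1) + 2 ^ (m + 2) + 6) * real l ^ 2
               - (2 ^ (2 * m + 1) + 7 * 2 ^ m + 5) * real l + (2 ^ m + 1) ^ 2) / (2 * real l ^ 3) \<and>
      real (weight_count (2 ^ n - 1) C (2 ^ (2 * m - 1) + 2 ^ (m - 1))) =
           (2 ^ (2 * m) - 1) *
             (6 * (2 ^ (2 * m) + 1) * real l ^ 3
               - (6 * 2 ^ (2 * m) + 9 * 2 ^ m + 11) * real l ^ 2
               + (3 * 2 ^ (2 * m) + 9 * 2 ^ m + 6) * real l - (2 ^ m + 1) ^ 2)
             / (6 * real l ^ 3)"
proof -
  note asm = assms
  define Q :: nat where "Q = 2 ^ m"
  define v where "v = (Q + 1) div l"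
  have Q4: "4 \<le> Q"
    using power_increasing[OF asm(1), of "2::nat"] by (simp add: Q_def)
  have lv: "Q + 1 = l * v"
    using asm(17) by (simp add: v_def Q_def)
  have kpos: "0 < k" using asm(6) by simp
  \<comment> \<open>In the first case \<open>k\<close> divides \<open>m + 1\<close>, which is
    coprime to \<open>m\<close>.\<close>
  have cop: "coprime k m"
    using asm(18)
  proof
    assume "[int m = -1] (mod int k)"
    then have "int k dvd int (m + 1)" by (simp add: cong_iff_dvd_diff add.commute)
    then have "k dvd m + 1" by (simp only: int_dvd_int_iff)
    moreover have "coprime (m + 1) m" by simp
    ultimately show ?thesis by (metis coprime_divisors dvd_refl)
  next
    assume "gcd k (2 * m) = 1"
    then show ?thesis by (metis coprime_iff_gcd_eq_1 coprime_mult_right_iff)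
  qed
  \<comment> \<open>If \<open>v\<close> divided \<open>2 ^ k - 1\<close> or
    \<open>2 ^ k + 1\<close>, then \<open>Q + 1 = l * v\<close> would divide that number times
    \<open>t\<close>. This excludes \<open>v = 1\<close>, and also \<open>v = 3\<close>, since 3
    divides one of the two numbers; moreover \<open>v\<close> is odd.\<close>
  have v5: "5 \<le> v"
  proof -
    have no: "\<not> v dvd 2 ^ k - 1" "\<not> v dvd 2 ^ k + 1"
    proof -
      have "l * v dvd x * t" if "v dvd x" for x
        using mult_dvd_mono[of l t v x] that asm(17) by (simp add: mult.commute)
      then show "\<not> v dvd 2 ^ k - 1" "\<not> v dvd 2 ^ k + 1"
        using asm(15,16) unfolding cong_0_iff lv [unfolded Q_def, symmetric] by blast+
    qed
    have "odd (Q + 1)" using asm(1) by (simp add: Q_def)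
    then have "odd v" using lv by (metis even_mult_iff)
    moreover have "v \<noteq> 1" using no(1) by auto
    moreover have "v \<noteq> 3"
    proof
      assume v3: "v = 3"
      have "(2::nat) ^ k mod 3 = 1 \<or> (2::nat) ^ k mod 3 = 2"
        by (induction k) (simp, simp, presburger)
      then have "3 dvd (2::nat) ^ k - 1 \<or> 3 dvd (2::nat) ^ k + 1" by presburger
      then show False using no v3 by simp
    qed
    ultimately show ?thesis by presburger
  qed
  \<comment> \<open>Oddness of \<open>t\<close> makes the halves exact, and
    \<open>2 ^ (k - 1) = Suc e\<close> resolves the truncated subtractions.\<close>
  have two_s: "2 * s1 = (2 ^ k - 1) * t + 1" "2 * s2 = (2 ^ k + 1) * t + 1"
  proof -
    obtain r where r: "t = 2 * r + 1" using asm(8) by (auto elim: oddE)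
    obtain c where c: "k = Suc c" using kpos by (cases k) auto
    have "(1::nat) \<le> 2 ^ c" by simp
    then obtain e where e: "(2::nat) ^ c = Suc e" by (metis Suc_le_D One_nat_def)
    show "2 * s1 = (2 ^ k - 1) * t + 1" "2 * s2 = (2 ^ k + 1) * t + 1"
      unfolding asm(11,12) r c by (simp_all add: e algebra_simps)
  qed
  have "CARD('a) = Q * Q" "l = gcd t (Q + 1)" "d1 = s1 * (Q - 1) + 1" "d2 = s2 * (Q - 1) + 1"
    unfolding Q_def asm(2,3,4,13,14,17) by (simp_all only: mult_2 power_add)
  then interpret niho_pair \<theta> m Q k t l v s1 s2 d1 d2
    by unfold_locales (rule asm(1) Q_def asm(5) cop kpos lv v5 two_s | assumption)+
  have N: "2 ^ n - 1 = Q * Q - 1" "q = Q * Q"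
    using asm(2,3) by (simp_all add: Q_def mult_2 power_add)
  have C: "C = code" using asm(19) N by simp
  have L: "0 < real l" "real Q + 1 = real l * real v"
    using l_pos arg_cong[OF lv, of real] by simp_all
  have X1: "(2::real) ^ m = real Q" by (simp add: Q_def)
  have X2: "(2::real) ^ (2 * m) = real Q ^ 2" by (simp only: power_even_eq X1)
  have X3: "(2::real) ^ (2 * m + 1) = 2 * real Q ^ 2" by (simp add: X2)
  have X4: "(2::real) ^ (m + 2) = 4 * real Q" by (simp add: power_add X1)
  have W: "W 3 = 2 ^ (2 * m - 1) - (3 * int l - 1) * 2 ^ (m - 1)"
    "W 2 = 2 ^ (2 * m - 1) - (2 * int l - 1) * 2 ^ (m - 1)"
    "W 1 = 2 ^ (2 * m - 1) - (int l - 1) * 2 ^ (m - 1)"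
    "W 0 = 2 ^ (2 * m - 1) + 2 ^ (m - 1)"
    by (simp_all add: W_def)
  have count: "weight_count (Q * Q - 1) C (W 3) = A 3" "weight_count (Q * Q - 1) C (W 2) = A 2"
    "weight_count (Q * Q - 1) C (W 1) = A 1" "weight_count (Q * Q - 1) C (W 0) = A 0"
    using weight_count_W[of 3] weight_count_W[of 2] weight_count_W[of 1] weight_count_W[of 0]
    by (simp_all add: C)
  show ?thesis
    unfolding N(1) W [symmetric] X1 X2 X3 X4 count counts_real[OF L]
    using linear_code_code min_distance_code weights weight_count_0
    by (simp add: C algebra_simps del: One_nat_def)
qed

end
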